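(* Let $A$ be a real symmetric positive definite $n\times n$ matrix. Given an integer $K\ge1$, let $\mathrm{Inv}(A)$ denote the solver for $A^{-1}$ using a $K$-level multiresolution operator decomposition with localization, with level matrices $\widetilde A^{(k)},\widetilde B^{(k)}$, bases $\Psi^{(k)}=[\psi_i^{(k)}]$, $\widetilde\Psi^{(k)}=[\tilde\psi_i^{(k)}]$ and level dimensions $N^{(k)}$. Assume that (i) each $(\widetilde B^{(k)})^{-1}$ is solved up to a uniform relative error $\mathrm{err}_B$, in the sense that the linear operator $\mathrm{Inv}(\widetilde B^{(k)})$ satisfies $$\|(\widetilde B^{(k)})^{-1}b-\mathrm{Inv}(\widetilde B^{(k)})b\|_{\widetilde B^{(k)}}\le\mathrm{err}_B\|b\|_{(\widetilde B^{(k)})^{-1}}\quad\text{for all }b\in\mathbb{R}^{N^{(k-1)}-N^{(k)}},\ 1\le k\le K;$$ (ii) at level $K$, $(\widetilde A^{(K)})^{-1}$ is solved up to a relative error $\mathrm{err}_A^{(K)}$, in the sense that the linear operator $\mathrm{Inv}(\widetilde A^{(K)})$ satisfies $$\|(\widetilde A^{(K)})^{-1}b-\mathrm{Inv}(\widetilde A^{(K)})b\|_{\widetilde A^{(K)}}\le\mathrm{err}_A^{(K)}\|b\|_{(\widetilde A^{(K)})^{-1}}\quad\text{for all }b\in\mathbb{R}^{N^{(K)}};$$ (iii) each $\widetilde\Psi^{(k)}$, $1\le k\le K$, satisfies $$\|\tilde\psi_i^{(k)}-\psi_i^{(k)}\|_{\widetilde A^{(k-1)}}\le\frac{\mathrm{err}_{loc}}{2\sqrt{N^{(k)}\|A^{-1}\|_2}},\quad1\le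 i\le N^{(k)},$$ with a uniform constant $\mathrm{err}_{loc}$. Then $$\|A^{-1}b-\mathrm{Inv}(A)b\|_A\le\mathrm{err}_{total}\|b\|_{A^{-1}}\quad\text{for all }b\in\mathbb{R}^n,$$ and $$\|A^{-1}b-\mathrm{Inv}(A)b\|_2\le\mathrm{err}_{total}\|A^{-1}\|_2\|b\|_2\quad\text{for all }b\in\mathbb{R}^n,$$ where $\mathrm{err}_{total}=K(\mathrm{err}_B+\mathrm{err}_{loc})+\mathrm{err}_A^{(K)}$.
   Context: For a symmetric positive definite matrix $X$, $\|x\|_X=\sqrt{x^TXx}$; $\|\cdot\|_2$ is the Euclidean/spectral norm. One-level objects. Let $A$ be symmetric positive definite on $\mathbb{R}^n$ and $\mathcal{V}$ an orthonormal basis of $\mathbb{R}^n$, with $u\sim v$ iff $u^TAv\neq0$ for $u,v\in\mathcal{V}$. A partition $\mathcal{P}=\{P_j\}_{j=1}^M$ of $\mathcal{V}$ is a family of pairwise disjoint subsets with union $\mathcal{V}$. $\Phi=[\Phi_1,\dots,\Phi_M]=[\varphi_1,\dots,\varphi_N]$, where the columns of $\Phi_j$ form an orthonormal basis of a subspace of $\mathrm{span}\{P_j\}$; $U=[U_1,\dots,U_M]$, where the columns of $U_j$ form a basis of the orthogonal complement of $\mathrm{span}(\Phi_j)$ in $\mathrm{span}\{P_j\}$; $\Psi=[\psi_1,\dots,\psi_N]=A^{-1}\Phi(\Phi^TA^{-1}\Phi)^{-1}$. Local approximators: $S_0(P_j)=P_j$, $S_{r+1}(P_j)=\bigcup\{P_{j'}:u\sim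 v\text{ for some }u\in P_{j'},v\in S_r(P_j)\}$. If $\varphi_i$ is a column of $\Phi_{j_i}$, then $\psi_i^r$ is the minimizer of $\|x\|_A$ over $x\in\mathrm{span}\{S_r(P_{j_i})\}$ subject to $\varphi_{i'}^Tx=\delta_{i',i}$ for all $i'$. A local approximator of $\Psi$ is a matrix $\widetilde\Psi=[\tilde\psi_1,\dots,\tilde\psi_N]$ with $\tilde\psi_i=\psi_i^{r_i}$ for some integers $r_i\ge0$. $K$-level multiresolution decomposition with localization: $\widetilde A^{(0)}=A$, $N^{(0)}=n$. For $k=1,\dots,K$, choose an orthonormal basis $\mathcal{V}^{(k-1)}$ of $\mathbb{R}^{N^{(k-1)}}$, a partition $\mathcal{P}^{(k)}=\{P_j^{(k)}\}_{j=1}^{M^{(k)}}$ of it, a matrix $\Phi^{(k)}=[\Phi_1^{(k)},\dots,\Phi_{M^{(k)}}^{(k)}]$, where the columns of $\Phi_j^{(k)}$ form an orthonormal basis of a subspace of $\mathrm{span}\{P_j^{(k)}\}$, and a matrix $U^{(k)}=[U_1^{(k)},\dots,U_{M^{(k)}}^{(k)}]$, where the columns of $U_j^{(k)}$ form a basis of the orthogonal complement of $\mathrm{span}(\Phi_j^{(k)})$ in $\mathrm{span}\{P_j^{(k)}\}$; let $\Psi^{(k)}=(\widetilde A^{(k-1)})^{-1}\Phi^{(k)}\big((\Phi^{(k)})^T(\widetilde A^{(k-1)})^{-1}\Phi^{(k)}\big)^{-1}$ and let $\widetilde\Psi^{(k)}$ be a local approximator of $\Psi^{(k)}$ (defined with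 $\widetilde A^{(k-1)},\mathcal{V}^{(k-1)},\mathcal{P}^{(k)},\Phi^{(k)}$ in the roles of $A,\mathcal{V},\mathcal{P},\Phi$); let $N^{(k)}$ be the number of columns of $\Phi^{(k)}$, and set $\widetilde A^{(k)}=(\widetilde\Psi^{(k)})^T\widetilde A^{(k-1)}\widetilde\Psi^{(k)}$, $\widetilde B^{(k)}=(U^{(k)})^T\widetilde A^{(k-1)}U^{(k)}$ (a square matrix of size $N^{(k-1)}-N^{(k)}$). Solver: given linear operators $\mathrm{Inv}(\widetilde B^{(k)})$ ($1\le k\le K$) and $\mathrm{Inv}(\widetilde A^{(K)})$, define recursively for $k=K,\dots,1$ $$\mathrm{Inv}(\widetilde A^{(k-1)})=U^{(k)}\,\mathrm{Inv}(\widetilde B^{(k)})\,(U^{(k)})^T+\widetilde\Psi^{(k)}\,\mathrm{Inv}(\widetilde A^{(k)})\,(\widetilde\Psi^{(k)})^T,$$ and $\mathrm{Inv}(A)=\mathrm{Inv}(\widetilde A^{(0)})$. *)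

theory Defs
  imports
    Complex_Main
    "Jordan_Normal_Form.VS_Connect"
    "Jordan_Normal_Form.Gauss_Jordan_Elimination"
begin

text \<open>
  The level dimensions vary with the level, so \<open>\<real>\<^sup>m\<close> is \<^term>\<open>carrier_vec m :: real vec set\<close>
  and matrices are those of \<^theory>\<open>Jordan_Normal_Form.Matrix\<close>.  Degenerate sizes (no rows, no
  columns) are allowed.
\<close>

abbreviation Rvec :: "nat \<Rightarrow> (real, real vec) module" where
  "Rvec m \<equiv> module_vec TYPE(real) m"

abbreviation vspan :: "nat \<Rightarrow> real vec set \<Rightarrow> real vec set" where
  "vspan m \<equiv> LinearCombinations.module.span class_ring (Rvec m)"

text \<open>Only meaningful for invertible \<open>X\<close>.\<close>
definition minv :: "real mat \<Rightarrow> real mat" where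
  "minv X = the (mat_inverse X)"

definition spd :: "nat \<Rightarrow> real mat \<Rightarrow> bool" where
  "spd m X \<longleftrightarrow> X \<in> carrier_mat m m \<and> X\<^sup>T = X \<and>
     (\<forall>x\<in>carrier_vec m. x \<noteq> 0\<^sub>v m \<longrightarrow> 0 < x \<bullet> (X *\<^sub>v x))"

definition norm2 :: "real vec \<Rightarrow> real" where
  "norm2 x = sqrt (x \<bullet> x)"

definition energy_norm :: "real mat \<Rightarrow> real vec \<Rightarrow> real" where
  "energy_norm X x = sqrt (x \<bullet> (X *\<^sub>v x))"

text \<open>Same shape as \<open>onorm\<close>; the quotient is \<open>0\<close> at \<open>x = 0\<close>.\<close>
definition spectral_norm :: "real mat \<Rightarrow> real" where
  "spectral_norm X = (SUP x\<in>carrier_vec (dim_col X). norm2 (X *\<^sub>v x) / norm2 x)"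

definition basis_of :: "nat \<Rightarrow> real vec set \<Rightarrow> real vec set \<Rightarrow> bool" where
  "basis_of m W B \<longleftrightarrow> B \<subseteq> carrier_vec m \<and>
     \<not> LinearCombinations.module.lin_dep class_ring (Rvec m) B \<and> vspan m B = W"

definition orthonormal_basis_of :: "nat \<Rightarrow> real vec set \<Rightarrow> real vec set \<Rightarrow> bool" where
  "orthonormal_basis_of m W B \<longleftrightarrow> basis_of m W B \<and>
     (\<forall>u\<in>B. \<forall>v\<in>B. u \<bullet> v = (if u = v then 1 else 0))"

definition orth_complement_in :: "real vec set \<Rightarrow> real vec set \<Rightarrow> real vec set" where
  "orth_complement_in X W = {x \<in> X. \<forall>y\<in>W. x \<bullet> y = 0}"

definition hcat :: "nat \<Rightarrow> real mat list \<Rightarrow> real mat" where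
  "hcat m Xs = mat_of_cols m (concat (map cols Xs))"


section \<open>One level\<close>

text \<open>
  The data chosen at one level: the orthonormal basis \<open>\<V>\<close>, the number \<open>M\<close> of patches, the patches
  \<open>P\<^sub>j\<close>, the blocks \<open>\<Phi>\<^sub>j\<close> and \<open>U\<^sub>j\<close>, and the localized basis.  Patches and blocks are indexed by
  \<open>j < M\<close>; values at larger \<open>j\<close> are irrelevant.
\<close>

record level =
  basisV :: "real vec set"
  npatch :: nat
  patch :: "nat \<Rightarrow> real vec set"
  phi_block :: "nat \<Rightarrow> real mat"
  u_block :: "nat \<Rightarrow> real mat"
  psi_loc :: "real mat"

definition Phi_mat :: "nat \<Rightarrow> level \<Rightarrow> real mat" where
  "Phi_mat m l = hcat m (map (phi_block l) [0..<npatch l])"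

definition U_mat :: "nat \<Rightarrow> level \<Rightarrow> real mat" where
  "U_mat m l = hcat m (map (u_block l) [0..<npatch l])"

definition Psi_mat :: "real mat \<Rightarrow> real mat \<Rightarrow> real mat" where
  "Psi_mat A Phi = minv A * Phi * minv (Phi\<^sup>T * minv A * Phi)"

primrec nbhd :: "real mat \<Rightarrow> nat \<Rightarrow> (nat \<Rightarrow> real vec set) \<Rightarrow> nat \<Rightarrow> nat \<Rightarrow> real vec set" where
  "nbhd A M P j 0 = P j"
| "nbhd A M P j (Suc r) =
     \<Union> {P j' | j'. j' < M \<and> (\<exists>u\<in>P j'. \<exists>v\<in>nbhd A M P j r. u \<bullet> (A *\<^sub>v v) \<noteq> 0)}"

text \<open>\<open>x\<close> is \<open>\<psi>\<^sub>i\<^sup>r\<close>, where \<open>j\<close> is the index of the block containing \<open>\<phi>\<^sub>i\<close>.\<close>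
definition is_local_psi ::
  "real mat \<Rightarrow> nat \<Rightarrow> level \<Rightarrow> nat \<Rightarrow> nat \<Rightarrow> nat \<Rightarrow> real vec \<Rightarrow> bool" where
  "is_local_psi A m l j i r x \<longleftrightarrow>
     is_arg_min (energy_norm A)
       (\<lambda>x. x \<in> vspan m (nbhd A (npatch l) (patch l) j r) \<and>
            (\<forall>i' < dim_col (Phi_mat m l).
               col (Phi_mat m l) i' \<bullet> x = (if i' = i then 1 else 0))) x"

definition local_approximator :: "real mat \<Rightarrow> nat \<Rightarrow> level \<Rightarrow> bool" where
  "local_approximator A m l \<longleftrightarrow>
     psi_loc l \<in> carrier_mat m (dim_col (Phi_mat m l)) \<and>
     (\<exists>r :: nat \<Rightarrow> nat. \<forall>i < dim_col (Phi_mat m l). \<forall>j < npatch l.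
        col (Phi_mat m l) i \<in> set (cols (phi_block l j)) \<longrightarrow>
        is_local_psi A m l j i (r i) (col (psi_loc l) i))"

definition level_ok :: "real mat \<Rightarrow> nat \<Rightarrow> level \<Rightarrow> bool" where
  "level_ok A m l \<longleftrightarrow>
     orthonormal_basis_of m (carrier_vec m) (basisV l) \<and>
     disjoint_family_on (patch l) {..<npatch l} \<and>
     (\<Union>j<npatch l. patch l j) = basisV l \<and>
     (\<forall>j<npatch l.
        dim_row (phi_block l j) = m \<and> distinct (cols (phi_block l j)) \<and>
        (\<exists>W. VectorSpace.subspace class_ring W (Rvec m) \<and> W \<subseteq> vspan m (patch l j) \<and>
             orthonormal_basis_of m W (set (cols (phi_block l j))))) \<and>
     (\<forall>j<npatch l.
        dim_row (u_block l j) = m \<and> distinct (cols (u_block l j)) \<and>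
        basis_of m
          (orth_complement_in (vspan m (patch l j)) (vspan m (set (cols (phi_block l j)))))
          (set (cols (u_block l j)))) \<and>
     local_approximator A m l"


section \<open>The multilevel decomposition and the solver\<close>

text \<open>\<open>L k\<close> is the data of level \<open>k\<close>, for \<open>1 \<le> k \<le> K\<close>; \<open>n\<close> is the size of \<open>A\<close>.\<close>

primrec levN :: "nat \<Rightarrow> (nat \<Rightarrow> level) \<Rightarrow> nat \<Rightarrow> nat" where
  "levN n L 0 = n"
| "levN n L (Suc k) = dim_col (Phi_mat (levN n L k) (L (Suc k)))"

primrec levA :: "real mat \<Rightarrow> (nat \<Rightarrow> level) \<Rightarrow> nat \<Rightarrow> real mat" where
  "levA A L 0 = A"
| "levA A L (Suc k) = (psi_loc (L (Suc k)))\<^sup>T * levA A L k * psi_loc (L (Suc k))"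

definition levU :: "nat \<Rightarrow> (nat \<Rightarrow> level) \<Rightarrow> nat \<Rightarrow> real mat" where
  "levU n L k = U_mat (levN n L (k - 1)) (L k)"

definition levB :: "nat \<Rightarrow> real mat \<Rightarrow> (nat \<Rightarrow> level) \<Rightarrow> nat \<Rightarrow> real mat" where
  "levB n A L k = (levU n L k)\<^sup>T * levA A L (k - 1) * levU n L k"

definition levPsi :: "nat \<Rightarrow> real mat \<Rightarrow> (nat \<Rightarrow> level) \<Rightarrow> nat \<Rightarrow> real mat" where
  "levPsi n A L k = Psi_mat (levA A L (k - 1)) (Phi_mat (levN n L (k - 1)) (L k))"

definition multires_decomposition ::
  "nat \<Rightarrow> real mat \<Rightarrow> nat \<Rightarrow> (nat \<Rightarrow> level) \<Rightarrow> bool" where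
  "multires_decomposition n A K L \<longleftrightarrow>
     (\<forall>k\<in>{1..K}. level_ok (levA A L (k - 1)) (levN n L (k - 1)) (L k))"

text \<open>
  \<open>solver n K L InvB InvAK k\<close> is the operator \<open>Inv\<close> of the level-\<open>k\<close> matrix, \<open>InvB k\<close> that of the
  matrix \<^term>\<open>levB n A L k\<close> and \<open>InvAK\<close> that of \<^term>\<open>levA A L K\<close>.
\<close>
function solver ::
  "nat \<Rightarrow> nat \<Rightarrow> (nat \<Rightarrow> level) \<Rightarrow> (nat \<Rightarrow> real vec \<Rightarrow> real vec) \<Rightarrow> (real vec \<Rightarrow> real vec) \<Rightarrow>
   nat \<Rightarrow> real vec \<Rightarrow> real vec" where
  "solver n K L InvB InvAK k b =
     (if K \<le> k then InvAK b
      else levU n L (Suc k) *\<^sub>v InvB (Suc k) ((levU n L (Suc k))\<^sup>T *\<^sub>v b) +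
           psi_loc (L (Suc k)) *\<^sub>v
             solver n K L InvB InvAK (Suc k) ((psi_loc (L (Suc k)))\<^sup>T *\<^sub>v b))"
  by auto
termination
  by (relation "measure (\<lambda>(n, K, L, InvB, InvAK, k, b). K - k)") auto

declare solver.simps [simp del]

end

theory Submission
  imports Defs "Jordan_Normal_Form.DL_Rank"
begin

text \<open>
  Write \<open>A\<close> for the matrix of one level, \<open>x = A\<^sup>-\<^sup>1 b\<close>, and measure everything in the energy norm of
  \<open>A\<close>.  The columns of \<open>U\<close> span the kernel of \<open>\<Phi>\<^sup>T\<close>, and \<open>\<Psi>\<close> spans exactly the energy-orthogonal
  complement of that kernel.  Hence \<open>x = v + h\<close> orthogonally, where \<open>v = U B\<^sup>-\<^sup>1 U\<^sup>T b\<close> is the Galerkin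
  solution in the range of \<open>U\<close> and \<open>h = \<Psi> (\<Phi>\<^sup>T h)\<close>.  The solver replaces \<open>h\<close> by \<open>q\<close>, the Galerkin
  solution of the same problem in the range of the localized basis \<open>T\<close>, so the defect caused by
  localization is \<open>w = h - q\<close>.

  Both \<open>\<Psi>\<close> and \<open>T\<close> are biorthogonal to \<open>\<Phi>\<close>, so \<open>\<Phi>\<^sup>T\<close> reads off the coefficients of a vector in
  either range.  Since \<open>\<Phi>\<close> has orthonormal columns, those coefficients are bounded by the Euclidean
  norm of the vector, hence by \<open>\<parallel>A\<^sup>-\<^sup>1\<parallel>\<^sup>1\<^sup>/\<^sup>2\<close> times its energy norm.  Together with the bound on the
  columns of \<open>T - \<Psi>\<close> this says that \<open>(T - \<Psi>) \<Phi>\<^sup>T\<close> has energy operator norm at most half the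
  localization tolerance \<open>e\<close>.  Splitting \<open>w = (h - T \<Phi>\<^sup>T h) + T \<Phi>\<^sup>T w\<close> in \<open>\<langle>w, w\<rangle>\<close> and using that \<open>v\<close> is
  orthogonal to \<open>\<Psi>\<close> and \<open>x - q\<close> to \<open>T\<close> gives \<open>\<parallel>w\<parallel>\<^sup>2 \<le> e / 2 * (\<parallel>h\<parallel> + \<parallel>v\<parallel>) * \<parallel>w\<parallel>\<close>, and therefore
  \<open>\<parallel>w\<parallel> \<le> e * \<parallel>x\<parallel>\<close> (lemma \<open>localization_defect\<close>).

  An inexact coarse solve costs no more than its own relative error, because a Galerkin solution
  has at most the energy of the exact one (lemma \<open>inexact_galerkin_error\<close>).  So the relative errors
  of the two subproblems and the localization defect simply add up at each level, and downward
  induction over the levels produces the stated total.  What makes the tolerance uniform is that the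
  Euclidean norm is dominated by the energy norm of every level with the constant of the finest one:
  this is inherited through \<open>\<Phi>\<^sup>T T = 1\<close> (lemma \<open>norm2_le_levA\<close>).

  That \<open>U\<close> is a basis of the kernel of \<open>\<Phi>\<^sup>T\<close> with the right number of columns is read off from the
  patches: these span mutually orthogonal subspaces, each of which splits into the span of its
  \<open>\<Phi>\<close>-block and the span of its \<open>U\<close>-block.
\<close>

section \<open>Vectors and matrices\<close>

lemma mult_mat_zero_vec [simp]: "X \<in> carrier_mat r c \<Longrightarrow> X *\<^sub>v 0\<^sub>v c = (0\<^sub>v r :: real vec)"
  by (intro eq_vecI) auto

lemma vec_minus_add:
  assumes "x \<in> carrier_vec m" "y \<in> carrier_vec m"
  shows "x - y + y = (x :: real vec)"
  using assms by (intro eq_vecI) auto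

lemma vec_eq_of_diff_eq_0:
  assumes x: "x \<in> carrier_vec m" and y: "y \<in> carrier_vec m" and 0: "x - y = 0\<^sub>v m"
  shows "x = (y :: real vec)"
proof (rule eq_vecI)
  fix i assume i: "i < dim_vec y"
  have "(x - y) $ i = 0"
    using 0 i y by simp
  then show "x $ i = y $ i"
    using i x y by simp
qed (use x y in simp)

lemma left_inverse_mult_vec:
  assumes "P \<in> carrier_mat m N" "T \<in> carrier_mat m N" "P\<^sup>T * T = 1\<^sub>m N" "c \<in> carrier_vec N"
  shows "P\<^sup>T *\<^sub>v (T *\<^sub>v c) = (c :: real vec)"
proof -
  have "P\<^sup>T *\<^sub>v (T *\<^sub>v c) = (P\<^sup>T * T) *\<^sub>v c"
    using assms by (intro assoc_mult_mat_vec[symmetric]) auto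
  then show ?thesis
    using assms by simp
qed


section \<open>The energy inner product\<close>

definition energy_inner :: "real mat \<Rightarrow> real vec \<Rightarrow> real vec \<Rightarrow> real" where
  "energy_inner A x y = x \<bullet> (A *\<^sub>v y)"

lemma spd_carrier [simp]: "spd m A \<Longrightarrow> A \<in> carrier_mat m m"
  by (simp add: spd_def)

context
  fixes m :: nat and A :: "real mat"
  assumes spd: "spd m A"
begin

lemma energy_inner_sym:
  assumes "x \<in> carrier_vec m" "y \<in> carrier_vec m"
  shows "energy_inner A x y = energy_inner A y x"
proof -
  have "energy_inner A x y = (A *\<^sub>v x) \<bullet> y"
    using transpose_vec_mult_scalar[of A m m y x] spd assms
    by (simp add: energy_inner_def spd_def)
  also have "\<dots> = energy_inner A y x"
    using comm_scalar_prod[of "A *\<^sub>v x" m y] spd_carrier[OF spd] assms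
    by (simp add: energy_inner_def)
  finally show ?thesis .
qed

lemma energy_inner_add_right:
  assumes "x \<in> carrier_vec m" "y \<in> carrier_vec m" "z \<in> carrier_vec m"
  shows "energy_inner A x (y + z) = energy_inner A x y + energy_inner A x z"
  using assms spd_carrier[OF spd]
  by (simp add: energy_inner_def mult_add_distrib_mat_vec[of _ m m] scalar_prod_add_distrib[of _ m])

lemma energy_inner_diff_right:
  assumes "x \<in> carrier_vec m" "y \<in> carrier_vec m" "z \<in> carrier_vec m"
  shows "energy_inner A x (y - z) = energy_inner A x y - energy_inner A x z"
  using assms spd_carrier[OF spd]
  by (simp add: energy_inner_def mult_minus_distrib_mat_vec[of _ m m] scalar_prod_minus_distrib[of _ m])

lemma energy_inner_smult_right:
  assumes "x \<in> carrier_vec m" "y \<in> carrier_vec m"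
  shows "energy_inner A x (c \<cdot>\<^sub>v y) = c * energy_inner A x y"
  using assms spd_carrier[OF spd] by (simp add: energy_inner_def mult_mat_vec[of _ m m])

lemma energy_inner_add_left:
  assumes "x \<in> carrier_vec m" "y \<in> carrier_vec m" "z \<in> carrier_vec m"
  shows "energy_inner A (x + y) z = energy_inner A x z + energy_inner A y z"
  using assms by (simp add: energy_inner_sym[of _ z] energy_inner_add_right)

lemma energy_inner_diff_left:
  assumes "x \<in> carrier_vec m" "y \<in> carrier_vec m" "z \<in> carrier_vec m"
  shows "energy_inner A (x - y) z = energy_inner A x z - energy_inner A y z"
  using assms by (simp add: energy_inner_sym[of _ z] energy_inner_diff_right)

lemma energy_inner_self_nonneg: "x \<in> carrier_vec m \<Longrightarrow> 0 \<le> energy_inner A x x"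
  using spd by (cases "x = 0\<^sub>v m") (auto simp: energy_inner_def spd_def intro: less_imp_le)

lemma energy_norm_square: "x \<in> carrier_vec m \<Longrightarrow> (energy_norm A x)\<^sup>2 = energy_inner A x x"
  using energy_inner_self_nonneg by (simp add: energy_norm_def energy_inner_def)

lemma energy_norm_nonneg: "x \<in> carrier_vec m \<Longrightarrow> 0 \<le> energy_norm A x"
  using energy_inner_self_nonneg by (simp add: energy_norm_def energy_inner_def)

lemma energy_norm_zero [simp]: "energy_norm A (0\<^sub>v m) = 0"
  using spd_carrier[OF spd] by (simp add: energy_norm_def)

lemma energy_norm_eq_0_iff:
  assumes "x \<in> carrier_vec m"
  shows "energy_norm A x = 0 \<longleftrightarrow> x = 0\<^sub>v m"
  using spd assms energy_norm_square[OF assms] energy_norm_zero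
  by (force simp: spd_def energy_inner_def)

lemma energy_inner_Cauchy_Schwarz:
  assumes x: "x \<in> carrier_vec m" and y: "y \<in> carrier_vec m"
  shows "\<bar>energy_inner A x y\<bar> \<le> energy_norm A x * energy_norm A y"
proof -
  let ?a = "energy_inner A x x" and ?b = "energy_inner A x y" and ?c = "energy_inner A y y"
  have "?b\<^sup>2 \<le> ?a * ?c"
  proof (cases "?c = 0")
    case True
    then have "energy_norm A y = 0"
      using energy_norm_square[OF y] by simp
    then have "y = 0\<^sub>v m"
      using energy_norm_eq_0_iff[OF y] by simp
    then show ?thesis
      using x spd_carrier[OF spd] by (simp add: energy_inner_def power2_eq_square)
  next
    case False
    then have c: "0 < ?c"
      using energy_inner_self_nonneg[OF y] by simp
    \<comment> \<open>a multiple of the component of \<open>x\<close> orthogonal to \<open>y\<close>\<close>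
    let ?z = "?c \<cdot>\<^sub>v x - ?b \<cdot>\<^sub>v y"
    have "0 \<le> energy_inner A ?z ?z"
      using x y by (intro energy_inner_self_nonneg) auto
    also have "energy_inner A ?z ?z = ?c * (?a * ?c - ?b\<^sup>2)"
      using x y energy_inner_sym[OF x y]
      by (simp add: energy_inner_diff_left energy_inner_diff_right energy_inner_smult_right
          energy_inner_sym[of "_ \<cdot>\<^sub>v _"] power2_eq_square algebra_simps)
    finally show ?thesis
      using c by (simp add: zero_le_mult_iff)
  qed
  also have "\<dots> = (energy_norm A x * energy_norm A y)\<^sup>2"
    using x y by (simp add: energy_norm_square power_mult_distrib)
  finally show ?thesis
    using x y by (simp add: energy_norm_nonneg abs_le_square_iff[symmetric])
qed

lemma energy_norm_triangle:
  assumes x: "x \<in> carrier_vec m" and y: "y \<in> carrier_vec m"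
  shows "energy_norm A (x + y) \<le> energy_norm A x + energy_norm A y"
proof -
  have "(energy_norm A (x + y))\<^sup>2 = energy_inner A x x + 2 * energy_inner A x y + energy_inner A y y"
    using x y energy_inner_sym[OF x y]
    by (simp add: energy_norm_square energy_inner_add_left energy_inner_add_right)
  also have "\<dots> \<le> (energy_norm A x + energy_norm A y)\<^sup>2"
    using energy_inner_Cauchy_Schwarz[OF x y] x y
    by (simp add: power2_sum energy_norm_square)
  finally show ?thesis
    using x y by (auto intro: power2_le_imp_le simp: energy_norm_nonneg)
qed

end

lemma spd_one: "spd m (1\<^sub>m m)"
proof -
  have "0 < x \<bullet> x" if x: "x \<in> carrier_vec m" "x \<noteq> 0\<^sub>v m" for x :: "real vec"
  proof -
    obtain i where "i < m" "x $ i \<noteq> 0"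
      using x by (metis carrier_vecD eq_vecI index_zero_vec)
    then have "0 < (\<Sum>i<m. x $ i * x $ i)"
      by (intro sum_pos2[of _ i]) (auto simp: zero_less_mult_iff not_less less_le)
    then show ?thesis
      using x by (simp add: scalar_prod_def lessThan_atLeast0)
  qed
  then show ?thesis
    by (simp add: spd_def)
qed

lemma norm2_eq_energy_norm: "x \<in> carrier_vec m \<Longrightarrow> norm2 x = energy_norm (1\<^sub>m m) x"
  by (simp add: norm2_def energy_norm_def)

lemma norm2_square: "x \<in> carrier_vec m \<Longrightarrow> (norm2 x)\<^sup>2 = x \<bullet> x"
  using energy_norm_square[OF spd_one, of x m] by (simp add: norm2_eq_energy_norm energy_inner_def)

lemma norm2_nonneg: "x \<in> carrier_vec m \<Longrightarrow> 0 \<le> norm2 x"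
  using energy_norm_nonneg[OF spd_one, of x m] by (simp add: norm2_eq_energy_norm)

lemma norm2_eq_0_iff: "x \<in> carrier_vec m \<Longrightarrow> norm2 x = 0 \<longleftrightarrow> x = 0\<^sub>v m"
  using energy_norm_eq_0_iff[OF spd_one, of x m] by (simp add: norm2_eq_energy_norm)

lemma scalar_prod_Cauchy_Schwarz:
  "x \<in> carrier_vec m \<Longrightarrow> y \<in> carrier_vec m \<Longrightarrow> \<bar>x \<bullet> y\<bar> \<le> norm2 x * norm2 y"
  using energy_inner_Cauchy_Schwarz[OF spd_one, of x m y] by (simp add: norm2_eq_energy_norm energy_inner_def)

lemma scalar_prod_self_eq_0: "x \<in> carrier_vec m \<Longrightarrow> x \<bullet> x = 0 \<Longrightarrow> x = (0\<^sub>v m :: real vec)"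
  using norm2_eq_0_iff[of x m] by (simp add: norm2_def)


section \<open>Inverses and congruences\<close>

definition full_col_rank :: "nat \<Rightarrow> nat \<Rightarrow> real mat \<Rightarrow> bool" where
  "full_col_rank m p V \<longleftrightarrow> V \<in> carrier_mat m p \<and>
     (\<forall>c\<in>carrier_vec p. V *\<^sub>v c = 0\<^sub>v m \<longrightarrow> c = 0\<^sub>v p)"

lemma full_col_rank_carrier [simp]: "full_col_rank m p V \<Longrightarrow> V \<in> carrier_mat m p"
  by (simp add: full_col_rank_def)

lemma full_col_rankD:
  "full_col_rank m p V \<Longrightarrow> c \<in> carrier_vec p \<Longrightarrow> V *\<^sub>v c = 0\<^sub>v m \<Longrightarrow> c = 0\<^sub>v p"
  by (simp add: full_col_rank_def)

lemma full_col_rank_if_left_inverse: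
  assumes V: "V \<in> carrier_mat m p" and W: "W \<in> carrier_mat p m" and WV: "W * V = 1\<^sub>m p"
  shows "full_col_rank m p V"
  unfolding full_col_rank_def
proof (intro conjI ballI impI V)
  fix c :: "real vec" assume c: "c \<in> carrier_vec p" and 0: "V *\<^sub>v c = 0\<^sub>v m"
  have "c = (W * V) *\<^sub>v c"
    using c WV by simp
  also have "\<dots> = W *\<^sub>v (V *\<^sub>v c)"
    using V W c by simp
  finally show "c = 0\<^sub>v p"
    using 0 W by simp
qed

lemma full_col_rank_square_inverse:
  assumes A: "full_col_rank m m A"
  shows "minv A \<in> carrier_mat m m \<and> A * minv A = 1\<^sub>m m \<and> minv A * A = 1\<^sub>m m"
proof -
  have Ac: "A \<in> carrier_mat m m"
    using A by simp
  have "det A \<noteq> 0"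
    unfolding det_0_iff_vec_prod_zero_field[OF Ac] using full_col_rankD[OF A] by blast
  then have "mat_inverse A \<noteq> None"
    using det_non_zero_imp_unit[OF Ac, where b = "()"] mat_inverse(1)[OF Ac, where b = "()"] by blast
  then obtain B where "mat_inverse A = Some B"
    by blast
  then show ?thesis
    using mat_inverse(2)[OF Ac] by (simp add: minv_def)
qed

lemma spd_full_col_rank: "spd m A \<Longrightarrow> full_col_rank m m A"
  unfolding spd_def full_col_rank_def by (metis less_irrefl scalar_prod_right_zero)

lemma spd_minv:
  assumes A: "spd m A"
  shows "minv A \<in> carrier_mat m m" "A * minv A = 1\<^sub>m m" "minv A * A = 1\<^sub>m m"
  using full_col_rank_square_inverse[OF spd_full_col_rank[OF A]] by auto

lemma spd_mult_minv:
  assumes A: "spd m A" and b: "b \<in> carrier_vec m"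
  shows "minv A *\<^sub>v b \<in> carrier_vec m" "A *\<^sub>v (minv A *\<^sub>v b) = b" "minv A *\<^sub>v (A *\<^sub>v b) = b"
  using spd_minv[OF A] spd_carrier[OF A] b
    assoc_mult_mat_vec[of A m m "minv A" m b] assoc_mult_mat_vec[of "minv A" m m A m b]
  by auto

lemma energy_norm_minv:
  assumes A: "spd m A" and b: "b \<in> carrier_vec m"
  shows "energy_norm (minv A) b = energy_norm A (minv A *\<^sub>v b)"
  using spd_mult_minv[OF A b] b
  by (simp add: energy_norm_def comm_scalar_prod[of "minv A *\<^sub>v b" m b])

lemma spd_of_minv:
  assumes A: "spd m A"
  shows "spd m (minv A)"
proof -
  have "(minv A)\<^sup>T = (minv A)\<^sup>T * (A * minv A)"
    using spd_minv[OF A] by simp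
  also have "\<dots> = ((minv A)\<^sup>T * A\<^sup>T) * minv A"
    using spd_minv[OF A] A by (simp add: spd_def assoc_mult_mat[of _ m m _ m _ m])
  also have "(minv A)\<^sup>T * A\<^sup>T = (A * minv A)\<^sup>T"
    using transpose_mult[OF spd_carrier[OF A] spd_minv(1)[OF A]] by simp
  finally have sym: "(minv A)\<^sup>T = minv A"
    using spd_minv[OF A] by simp
  have "0 < x \<bullet> (minv A *\<^sub>v x)" if x: "x \<in> carrier_vec m" "x \<noteq> 0\<^sub>v m" for x
  proof -
    let ?y = "minv A *\<^sub>v x"
    have y: "?y \<in> carrier_vec m" "A *\<^sub>v ?y = x"
      using spd_mult_minv[OF A x(1)] by auto
    have "?y \<noteq> 0\<^sub>v m"
      using x y spd_carrier[OF A] by auto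
    then have "0 < ?y \<bullet> (A *\<^sub>v ?y)"
      using A y(1) unfolding spd_def by blast
    then show ?thesis
      using x y by (simp add: comm_scalar_prod[of ?y m x])
  qed
  then show ?thesis
    using sym spd_minv[OF A] by (simp add: spd_def)
qed

lemma energy_inner_congruence:
  assumes A: "A \<in> carrier_mat m m" and V: "V \<in> carrier_mat m p"
    and c: "c \<in> carrier_vec p" and d: "d \<in> carrier_vec p"
  shows "energy_inner (V\<^sup>T * A * V) c d = energy_inner A (V *\<^sub>v c) (V *\<^sub>v d)"
proof -
  have "(V\<^sup>T * A * V) *\<^sub>v d = V\<^sup>T *\<^sub>v (A *\<^sub>v (V *\<^sub>v d))"
    using assoc_mult_mat_vec[of "V\<^sup>T * A" p m V p d] assoc_mult_mat_vec[of "V\<^sup>T" p m A m "V *\<^sub>v d"] assms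
    by (simp del: assoc_mult_mat_vec assoc_mult_mat)
  then have "energy_inner (V\<^sup>T * A * V) c d = (V\<^sup>T *\<^sub>v (A *\<^sub>v (V *\<^sub>v d))) \<bullet> c"
    using assms by (simp add: energy_inner_def comm_scalar_prod[of c p])
  also have "\<dots> = (A *\<^sub>v (V *\<^sub>v d)) \<bullet> (V *\<^sub>v c)"
    using assms by (intro transpose_vec_mult_scalar[of V m p]) auto
  finally show ?thesis
    using assms by (simp add: energy_inner_def comm_scalar_prod[of "A *\<^sub>v (V *\<^sub>v d)" m])
qed

lemma energy_norm_congruence:
  assumes "A \<in> carrier_mat m m" "V \<in> carrier_mat m p" "c \<in> carrier_vec p"
  shows "energy_norm (V\<^sup>T * A * V) c = energy_norm A (V *\<^sub>v c)"
  using energy_inner_congruence[OF assms assms(3)] by (simp add: energy_norm_def energy_inner_def)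

lemma spd_congruence:
  assumes A: "spd m A" and V: "full_col_rank m p V"
  shows "spd p (V\<^sup>T * A * V)"
proof -
  have Ac: "A \<in> carrier_mat m m" and Vc: "V \<in> carrier_mat m p"
    using A V by auto
  have "(V\<^sup>T * A * V)\<^sup>T = V\<^sup>T * (A\<^sup>T * V)"
    using transpose_mult[of "V\<^sup>T * A" p m V p] transpose_mult[of "V\<^sup>T" p m A m] Ac Vc
    by (simp del: assoc_mult_mat)
  then have "(V\<^sup>T * A * V)\<^sup>T = V\<^sup>T * A * V"
    using Ac Vc A by (simp add: spd_def assoc_mult_mat[of _ p m _ m _ p])
  moreover have "0 < c \<bullet> ((V\<^sup>T * A * V) *\<^sub>v c)" if c: "c \<in> carrier_vec p" "c \<noteq> 0\<^sub>v p" for c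
  proof -
    have "V *\<^sub>v c \<noteq> 0\<^sub>v m"
      using full_col_rankD[OF V] c by blast
    then show ?thesis
      using energy_inner_congruence[OF Ac Vc c(1) c(1)] A c Vc by (simp add: energy_inner_def spd_def)
  qed
  ultimately show ?thesis
    using Ac Vc by (simp add: spd_def)
qed

text \<open>
  \<open>V f\<close> is the energy-orthogonal projection of \<open>x = A\<^sup>-\<^sup>1 b\<close> onto the range of \<open>V\<close>.  The dual norm of
  \<open>V\<^sup>T b\<close>, in which errors of an inexact solve with \<open>V\<^sup>T A V\<close> are measured, is the energy of this
  projection, and so is at most the energy of \<open>x\<close>.
\<close>

lemma galerkin_coefficients:
  assumes A: "spd m A" and V: "full_col_rank m p V" and b: "b \<in> carrier_vec m"
  defines "f \<equiv> minv (V\<^sup>T * A * V) *\<^sub>v (V\<^sup>T *\<^sub>v b)" and "x \<equiv> minv A *\<^sub>v b"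
  shows "f \<in> carrier_vec p"
    and "c \<in> carrier_vec p \<Longrightarrow> energy_inner A (V *\<^sub>v c) (V *\<^sub>v f) = energy_inner A (V *\<^sub>v c) x"
    and "energy_norm (minv (V\<^sup>T * A * V)) (V\<^sup>T *\<^sub>v b) = energy_norm A (V *\<^sub>v f)"
    and "energy_norm A (V *\<^sub>v f) \<le> energy_norm A x"
proof -
  have Ac: "A \<in> carrier_mat m m" and Vc: "V \<in> carrier_mat m p"
    using A V by auto
  have B: "spd p (V\<^sup>T * A * V)"
    by (rule spd_congruence[OF A V])
  have g: "V\<^sup>T *\<^sub>v b \<in> carrier_vec p"
    using Vc b by simp
  note f = spd_mult_minv[OF B g, folded f_def]
  note x = spd_mult_minv[OF A b, folded x_def]
  show "f \<in> carrier_vec p"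
    by (rule f)
  show orth: "energy_inner A (V *\<^sub>v c) (V *\<^sub>v f) = energy_inner A (V *\<^sub>v c) x" if c: "c \<in> carrier_vec p" for c
  proof -
    have "energy_inner A (V *\<^sub>v c) (V *\<^sub>v f) = c \<bullet> (V\<^sup>T *\<^sub>v b)"
      using energy_inner_congruence[OF Ac Vc c f(1)] f(2) by (simp add: energy_inner_def)
    also have "\<dots> = (V\<^sup>T *\<^sub>v b) \<bullet> c"
      using g c by (simp add: comm_scalar_prod[of c p])
    also have "\<dots> = b \<bullet> (V *\<^sub>v c)"
      by (rule transpose_vec_mult_scalar[OF Vc c b])
    finally show ?thesis
      using x b Vc c by (simp add: energy_inner_def comm_scalar_prod[of b m])
  qed
  show "energy_norm (minv (V\<^sup>T * A * V)) (V\<^sup>T *\<^sub>v b) = energy_norm A (V *\<^sub>v f)"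
    using energy_norm_minv[OF B g] energy_norm_congruence[OF Ac Vc f(1)] by (simp add: f_def)
  have Vf: "V *\<^sub>v f \<in> carrier_vec m"
    using Vc f by simp
  have "(energy_norm A (V *\<^sub>v f))\<^sup>2 \<le> energy_norm A (V *\<^sub>v f) * energy_norm A x"
    using energy_inner_Cauchy_Schwarz[OF A Vf x(1)] orth[OF f(1)] energy_norm_square[OF A Vf] by simp
  then show "energy_norm A (V *\<^sub>v f) \<le> energy_norm A x"
    using energy_norm_nonneg[OF A Vf] energy_norm_nonneg[OF A x(1)]
    by (cases "energy_norm A (V *\<^sub>v f) = 0") (auto simp: power2_eq_square)
qed


section \<open>Euclidean and energy norms\<close>

lemma norm2_square_sum: "x \<in> carrier_vec m \<Longrightarrow> (norm2 x)\<^sup>2 = (\<Sum>i<m. (x $ i)\<^sup>2)"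
  using norm2_square[of x m] by (simp add: scalar_prod_def power2_eq_square lessThan_atLeast0)

lemma norm2_le_of_entries:
  assumes w: "w \<in> carrier_vec p" and a: "0 \<le> a" and le: "\<And>i. i < p \<Longrightarrow> \<bar>w $ i\<bar> \<le> a"
  shows "norm2 w \<le> sqrt p * a"
proof -
  have "(norm2 w)\<^sup>2 \<le> (\<Sum>i<p. a\<^sup>2)"
    unfolding norm2_square_sum[OF w] using a le
    by (intro sum_mono) (simp add: abs_le_square_iff[symmetric])
  also have "\<dots> = (sqrt p * a)\<^sup>2"
    by (simp add: power_mult_distrib)
  finally show ?thesis
    using a by (auto intro: power2_le_imp_le)
qed

text \<open>
  Needed before any property of the supremum in \<^const>\<open>spectral_norm\<close> can be used.  Summing the row
  norms is wasteful, but finiteness is all that matters.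
\<close>

lemma norm2_quotients_bdd:
  assumes X: "X \<in> carrier_mat m k"
  shows "bdd_above ((\<lambda>x. norm2 (X *\<^sub>v x) / norm2 x) ` carrier_vec k)"
proof (rule bdd_aboveI2)
  define C where "C = (\<Sum>i<m. norm2 (row X i))"
  have rowc: "row X i \<in> carrier_vec k" for i
    using X by (auto simp: row_def)
  have nn: "0 \<le> norm2 (row X i)" for i
    using norm2_nonneg[OF rowc] .
  fix x :: "real vec" assume x: "x \<in> carrier_vec k"
  have "norm2 (X *\<^sub>v x) \<le> sqrt m * (C * norm2 x)"
  proof (rule norm2_le_of_entries)
    show "X *\<^sub>v x \<in> carrier_vec m" "0 \<le> C * norm2 x"
      using X x nn norm2_nonneg[OF x] by (auto simp: C_def intro!: sum_nonneg mult_nonneg_nonneg)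
    fix i assume i: "i < m"
    have "\<bar>(X *\<^sub>v x) $ i\<bar> \<le> norm2 (row X i) * norm2 x"
      using scalar_prod_Cauchy_Schwarz[OF rowc x] X i by simp
    also have "\<dots> \<le> C * norm2 x"
      using i nn norm2_nonneg[OF x]
      by (auto simp: C_def intro!: mult_right_mono member_le_sum)
    finally show "\<bar>(X *\<^sub>v x) $ i\<bar> \<le> C * norm2 x" .
  qed
  moreover have "0 \<le> C"
    using nn by (auto simp: C_def intro: sum_nonneg)
  ultimately show "norm2 (X *\<^sub>v x) / norm2 x \<le> sqrt m * C"
    using norm2_nonneg[OF x] by (cases "norm2 x = 0") (auto simp: field_simps)
qed

lemma norm2_mult_le:
  assumes X: "X \<in> carrier_mat m k" and x: "x \<in> carrier_vec k"
  shows "norm2 (X *\<^sub>v x) \<le> spectral_norm X * norm2 x"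
proof (cases "norm2 x = 0")
  case True
  then show ?thesis
    using norm2_eq_0_iff[OF x] X by (simp add: norm2_def)
next
  case False
  have "norm2 (X *\<^sub>v x) / norm2 x \<le> spectral_norm X"
    unfolding spectral_norm_def using X x
    by (intro cSUP_upper) (auto intro: norm2_quotients_bdd)
  then show ?thesis
    using False norm2_nonneg[OF x] by (simp add: field_simps)
qed

lemma spectral_norm_nonneg:
  assumes X: "X \<in> carrier_mat m k"
  shows "0 \<le> spectral_norm X"
proof -
  have "norm2 (X *\<^sub>v 0\<^sub>v k) / norm2 (0\<^sub>v k :: real vec) \<le> spectral_norm X"
    unfolding spectral_norm_def using X
    by (intro cSUP_upper) (auto intro: norm2_quotients_bdd)
  then show ?thesis
    by (simp add: norm2_def)
qed

lemma energy_norm_minv_le_norm2: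
  assumes A: "spd m A" and b: "b \<in> carrier_vec m"
  shows "energy_norm (minv A) b \<le> sqrt (spectral_norm (minv A)) * norm2 b"
proof -
  have "b \<bullet> (minv A *\<^sub>v b) \<le> norm2 b * norm2 (minv A *\<^sub>v b)"
    using scalar_prod_Cauchy_Schwarz[OF b spd_mult_minv(1)[OF A b]] by linarith
  also have "\<dots> \<le> norm2 b * (spectral_norm (minv A) * norm2 b)"
    using norm2_mult_le[OF spd_minv(1)[OF A] b] norm2_nonneg[OF b] by (rule mult_left_mono)
  finally have "energy_norm (minv A) b \<le> sqrt (spectral_norm (minv A) * (norm2 b)\<^sup>2)"
    by (simp add: energy_norm_def power2_eq_square algebra_simps)
  then show ?thesis
    using norm2_nonneg[OF b] by (simp add: real_sqrt_mult)
qed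

text \<open>
  Euclidean length is an energy product, \<open>y \<bullet> y = \<langle>y, A\<^sup>-\<^sup>1 y\<rangle>\<close>, so Cauchy-Schwarz in the energy
  product reduces the bound to the one for the energy norm of \<open>A\<^sup>-\<^sup>1\<close>.
\<close>

lemma norm2_le_energy_norm:
  assumes A: "spd m A" and y: "y \<in> carrier_vec m"
  shows "norm2 y \<le> sqrt (spectral_norm (minv A)) * energy_norm A y"
proof (cases "norm2 y = 0")
  case True
  then show ?thesis
    using energy_norm_nonneg[OF A y] spectral_norm_nonneg[OF spd_minv(1)[OF A]] by simp
next
  case False
  let ?w = "minv A *\<^sub>v y"
  note w = spd_mult_minv[OF A y]
  have "(norm2 y)\<^sup>2 = energy_inner A y ?w"
    using w y by (simp add: norm2_square energy_inner_def)
  also have "\<dots> \<le> energy_norm A y * energy_norm A ?w"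
    using energy_inner_Cauchy_Schwarz[OF A y w(1)] by linarith
  also have "\<dots> \<le> energy_norm A y * (sqrt (spectral_norm (minv A)) * norm2 y)"
    using energy_norm_minv_le_norm2[OF A y] energy_norm_minv[OF A y] energy_norm_nonneg[OF A y]
    by (intro mult_left_mono) auto
  finally show ?thesis
    using False norm2_nonneg[OF y] by (simp add: power2_eq_square mult.commute)
qed

text \<open>
  The triangle inequality over the columns followed by Cauchy-Schwarz on the coefficients, carried
  out dually: with \<open>w = D\<^sup>T A D c\<close> the squared energy of \<open>D c\<close> is \<open>w \<bullet> c\<close>, and each entry of \<open>w\<close> is an
  energy product with a column of \<open>D\<close>.
\<close>

lemma energy_norm_mult_le_of_cols:
  assumes A: "spd m A" and D: "D \<in> carrier_mat m p" and d: "0 \<le> \<delta>"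
    and col: "\<And>i. i < p \<Longrightarrow> energy_norm A (col D i) \<le> \<delta>"
    and c: "c \<in> carrier_vec p"
  shows "energy_norm A (D *\<^sub>v c) \<le> sqrt p * \<delta> * norm2 c"
proof -
  let ?y = "D *\<^sub>v c" and ?E = "energy_norm A (D *\<^sub>v c)"
  let ?w = "D\<^sup>T *\<^sub>v (A *\<^sub>v ?y)"
  have Ac: "A \<in> carrier_mat m m" and y: "?y \<in> carrier_vec m"
    using A D c by auto
  have Ay: "A *\<^sub>v ?y \<in> carrier_vec m"
    using Ac y by simp
  have E: "0 \<le> ?E"
    by (rule energy_norm_nonneg[OF A y])
  have w: "norm2 ?w \<le> sqrt p * (\<delta> * ?E)"
  proof (rule norm2_le_of_entries)
    show "?w \<in> carrier_vec p" "0 \<le> \<delta> * ?E"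
      using D Ay d E by auto
    fix i assume i: "i < p"
    have ci: "col D i \<in> carrier_vec m"
      using D i by auto
    have "\<bar>?w $ i\<bar> = \<bar>energy_inner A (col D i) ?y\<bar>"
      using D i by (simp add: energy_inner_def)
    also have "\<dots> \<le> energy_norm A (col D i) * ?E"
      by (rule energy_inner_Cauchy_Schwarz[OF A ci y])
    also have "\<dots> \<le> \<delta> * ?E"
      using col[OF i] E by (rule mult_right_mono)
    finally show "\<bar>?w $ i\<bar> \<le> \<delta> * ?E" .
  qed
  have "?E\<^sup>2 = ?w \<bullet> c"
    using energy_norm_square[OF A y] transpose_vec_mult_scalar[OF D c Ay]
      comm_scalar_prod[OF y Ay] by (simp add: energy_inner_def)
  also have "\<dots> \<le> norm2 ?w * norm2 c"
    using scalar_prod_Cauchy_Schwarz[of ?w p c] D Ay c by fastforce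
  also have "\<dots> \<le> sqrt p * (\<delta> * ?E) * norm2 c"
    using w norm2_nonneg[OF c] by (rule mult_right_mono)
  finally have "?E * ?E \<le> (sqrt p * \<delta> * norm2 c) * ?E"
    by (simp add: power2_eq_square algebra_simps)
  moreover have "0 \<le> sqrt p * \<delta> * norm2 c"
    using d norm2_nonneg[OF c] by simp
  ultimately show ?thesis
    using E by (cases "?E = 0") auto
qed

text \<open>
  \<open>P\<^sup>T y\<close> holds the coordinates of the orthogonal projection of \<open>y\<close> onto the range of \<open>P\<close>.
\<close>

lemma norm2_transpose_orthonormal_le:
  assumes P: "P \<in> carrier_mat m N" and PP: "P\<^sup>T * P = 1\<^sub>m N" and y: "y \<in> carrier_vec m"
  shows "norm2 (P\<^sup>T *\<^sub>v y) \<le> norm2 y"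
proof -
  let ?c = "P\<^sup>T *\<^sub>v y"
  have c: "?c \<in> carrier_vec N" and Pc: "P *\<^sub>v ?c \<in> carrier_vec m"
    using P y by auto
  have "P\<^sup>T *\<^sub>v (P *\<^sub>v ?c) = (P\<^sup>T * P) *\<^sub>v ?c"
    using P c by simp
  then have "?c \<bullet> ?c = (P *\<^sub>v ?c) \<bullet> (P *\<^sub>v ?c)"
    using transpose_vec_mult_scalar[OF P c Pc] PP c by simp
  then have same: "norm2 (P *\<^sub>v ?c) = norm2 ?c"
    by (simp add: norm2_def)
  have "(norm2 ?c)\<^sup>2 = y \<bullet> (P *\<^sub>v ?c)"
    using transpose_vec_mult_scalar[OF P c y] norm2_square[OF c] by simp
  also have "\<dots> \<le> norm2 y * norm2 ?c"
    using scalar_prod_Cauchy_Schwarz[OF y Pc] same by simp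
  finally show ?thesis
    using norm2_nonneg[OF c] norm2_nonneg[OF y]
    by (cases "norm2 ?c = 0") (auto simp: power2_eq_square)
qed


section \<open>The exact multiresolution basis\<close>

text \<open>
  \<open>A \<Psi>\<close> factors through \<open>\<Phi>\<close>, which makes the range of \<open>\<Psi>\<close> energy-orthogonal to the kernel of
  \<open>\<Phi>\<^sup>T\<close>; the second factor of \<open>\<Psi>\<close> is the normalization that makes it biorthogonal to \<open>\<Phi>\<close>.
\<close>

lemma Psi_mat_props:
  assumes A: "spd m A" and P: "P \<in> carrier_mat m N" and PP: "P\<^sup>T * P = 1\<^sub>m N"
  shows "Psi_mat A P \<in> carrier_mat m N" and "P\<^sup>T * Psi_mat A P = 1\<^sub>m N"
    and "y \<in> carrier_vec m \<Longrightarrow> P\<^sup>T *\<^sub>v y = 0\<^sub>v N \<Longrightarrow> c \<in> carrier_vec N \<Longrightarrow>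
      energy_inner A y (Psi_mat A P *\<^sub>v c) = 0"
proof -
  let ?S = "P\<^sup>T * minv A * P"
  have "full_col_rank m N P"
    using P PP by (intro full_col_rank_if_left_inverse[of P m N "P\<^sup>T"]) auto
  then have S: "spd N ?S"
    by (rule spd_congruence[OF spd_of_minv[OF A]])
  have Ac: "A \<in> carrier_mat m m" and iA: "minv A \<in> carrier_mat m m"
    and iS: "minv ?S \<in> carrier_mat N N"
    using A spd_minv[OF A] spd_minv[OF S] by auto
  show Psi: "Psi_mat A P \<in> carrier_mat m N"
    using P iA iS by (simp add: Psi_mat_def)
  have "P\<^sup>T * (minv A * P * W) = P\<^sup>T * minv A * P * W" if "W \<in> carrier_mat N N" for W
    using assoc_mult_mat[of "P\<^sup>T" N m "minv A" m P N] that
      assoc_mult_mat[of "P\<^sup>T" N m "minv A * P" N W N] P iA by simp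
  then have "P\<^sup>T * Psi_mat A P = ?S * minv ?S"
    unfolding Psi_mat_def using iS by blast
  then show "P\<^sup>T * Psi_mat A P = 1\<^sub>m N"
    using spd_minv[OF S] by simp
  show "energy_inner A y (Psi_mat A P *\<^sub>v c) = 0"
    if y: "y \<in> carrier_vec m" and 0: "P\<^sup>T *\<^sub>v y = 0\<^sub>v N" and c: "c \<in> carrier_vec N"
  proof -
    have "A * (minv A * P * W) = P * W" if "W \<in> carrier_mat N N" for W
      using assoc_mult_mat[of A m m "minv A" m P N] that spd_minv(2)[OF A]
        assoc_mult_mat[of A m m "minv A * P" N W N] P iA Ac by simp
    then have "A * Psi_mat A P = P * minv ?S"
      unfolding Psi_mat_def using iS by blast
    then have eq: "A *\<^sub>v (Psi_mat A P *\<^sub>v c) = P *\<^sub>v (minv ?S *\<^sub>v c)"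
      using assoc_mult_mat_vec[OF Ac Psi c] assoc_mult_mat_vec[OF P iS c] by simp
    have "y \<bullet> (P *\<^sub>v (minv ?S *\<^sub>v c)) = (P\<^sup>T *\<^sub>v y) \<bullet> (minv ?S *\<^sub>v c)"
      using P y c iS by (intro transpose_vec_mult_scalar[symmetric, of P m N]) auto
    also have "\<dots> = 0"
      using 0 iS c by simp
    finally show ?thesis
      using eq by (simp add: energy_inner_def)
  qed
qed

text \<open>
  Conversely, the energy-orthogonal complement of the kernel of \<open>\<Phi>\<^sup>T\<close> is no larger than the range
  of \<open>\<Psi>\<close>: subtracting \<open>\<Psi> \<Phi>\<^sup>T h\<close> from \<open>h\<close> leaves a vector that lies in the kernel and is orthogonal
  to it.
\<close>

lemma in_range_Psi_mat:
  assumes A: "spd m A" and P: "P \<in> carrier_mat m N" and PP: "P\<^sup>T * P = 1\<^sub>m N"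
    and h: "h \<in> carrier_vec m"
    and orth: "\<And>y. y \<in> carrier_vec m \<Longrightarrow> P\<^sup>T *\<^sub>v y = 0\<^sub>v N \<Longrightarrow> energy_inner A y h = 0"
  shows "h = Psi_mat A P *\<^sub>v (P\<^sup>T *\<^sub>v h)"
proof -
  let ?c = "P\<^sup>T *\<^sub>v h" and ?h' = "Psi_mat A P *\<^sub>v (P\<^sup>T *\<^sub>v h)"
  note Psi = Psi_mat_props[OF A P PP]
  have c: "?c \<in> carrier_vec N" and h': "?h' \<in> carrier_vec m"
    using P h Psi(1) by auto
  have g: "h - ?h' \<in> carrier_vec m"
    using h h' by simp
  have "P\<^sup>T *\<^sub>v (h - ?h') = ?c - P\<^sup>T *\<^sub>v ?h'"
    using P h h' by (intro mult_minus_distrib_mat_vec[of _ N m]) auto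
  then have 0: "P\<^sup>T *\<^sub>v (h - ?h') = 0\<^sub>v N"
    using left_inverse_mult_vec[OF P Psi(1,2) c] c by simp
  have "energy_inner A (h - ?h') (h - ?h') = 0"
    using orth[OF g 0] Psi(3)[OF g 0 c] energy_inner_diff_right[OF A g h h'] by simp
  then have "h - ?h' = 0\<^sub>v m"
    using energy_norm_eq_0_iff[OF A g] energy_norm_square[OF A g] by simp
  then show ?thesis
    by (rule vec_eq_of_diff_eq_0[OF h h'])
qed


section \<open>One level\<close>

text \<open>
  The error of one level with exact inverses on both subspaces; it is nonzero only because
  \<open>T\<close> replaces \<open>\<Psi>\<close>.  The projections onto the ranges of \<open>\<Psi>\<close> and of \<open>T\<close> differ by a contribution of
  size \<open>e / 2\<close> from either side: how far \<open>h\<close> is from the range of \<open>T\<close>, and how far \<open>v\<close> is from being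
  orthogonal to that range.
\<close>

lemma localization_defect:
  assumes A: "spd m A" and U: "full_col_rank m p U"
    and P: "P \<in> carrier_mat m N" and PP: "P\<^sup>T * P = 1\<^sub>m N"
    and kernel: "\<And>y. y \<in> carrier_vec m \<Longrightarrow>
      P\<^sup>T *\<^sub>v y = 0\<^sub>v N \<longleftrightarrow> (\<exists>c\<in>carrier_vec p. y = U *\<^sub>v c)"
    and T: "T \<in> carrier_mat m N" and PT: "P\<^sup>T * T = 1\<^sub>m N"
    and s: "0 \<le> s" "\<And>y. y \<in> carrier_vec m \<Longrightarrow> norm2 y \<le> s * energy_norm A y"
    and d: "0 \<le> \<delta>" "\<And>c. c \<in> carrier_vec N \<Longrightarrow>
      energy_norm A (T *\<^sub>v c - Psi_mat A P *\<^sub>v c) \<le> \<delta> * norm2 c"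
    and sd: "s * \<delta> \<le> e / 2"
    and b: "b \<in> carrier_vec m"
  shows "energy_norm A (minv A *\<^sub>v b -
      (U *\<^sub>v (minv (U\<^sup>T * A * U) *\<^sub>v (U\<^sup>T *\<^sub>v b)) + T *\<^sub>v (minv (T\<^sup>T * A * T) *\<^sub>v (T\<^sup>T *\<^sub>v b))))
      \<le> e * energy_norm (minv A) b"
proof -
  let ?Psi = "Psi_mat A P"
  define x where "x = minv A *\<^sub>v b"
  define u where "u = minv (U\<^sup>T * A * U) *\<^sub>v (U\<^sup>T *\<^sub>v b)"
  define f where "f = minv (T\<^sup>T * A * T) *\<^sub>v (T\<^sup>T *\<^sub>v b)"
  have Ac: "A \<in> carrier_mat m m" and Uc: "U \<in> carrier_mat m p"
    using A U by auto
  have Tr: "full_col_rank m N T"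
    using T P PT by (intro full_col_rank_if_left_inverse[of T m N "P\<^sup>T"]) auto
  note Psi = Psi_mat_props[OF A P PP]
  note gU = galerkin_coefficients[OF A U b, folded u_def x_def]
  note gT = galerkin_coefficients[OF A Tr b, folded f_def x_def]
  define v where "v = U *\<^sub>v u"
  define q where "q = T *\<^sub>v f"
  define h where "h = x - v"
  define w where "w = h - q"
  define c where "c = P\<^sup>T *\<^sub>v h"
  have xc: "x \<in> carrier_vec m"
    using spd_mult_minv(1)[OF A b] by (simp add: x_def)
  have vc: "v \<in> carrier_vec m" and qc: "q \<in> carrier_vec m" and hc: "h \<in> carrier_vec m"
    and wc: "w \<in> carrier_vec m" and cc: "c \<in> carrier_vec N"
    using Uc T gU(1) gT(1) xc P by (auto simp: v_def q_def h_def w_def c_def)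
  have fc: "f \<in> carrier_vec N"
    by (rule gT(1))
  have kerv: "P\<^sup>T *\<^sub>v v = 0\<^sub>v N"
    using kernel[OF vc] gU(1) by (auto simp: v_def)
  have h_orth: "energy_inner A y h = 0" if y: "y \<in> carrier_vec m" "P\<^sup>T *\<^sub>v y = 0\<^sub>v N" for y
  proof -
    obtain k where k: "k \<in> carrier_vec p" "y = U *\<^sub>v k"
      using kernel y by blast
    then show ?thesis
      using gU(2)[OF k(1)] energy_inner_diff_right[OF A y(1) xc vc] by (simp add: h_def v_def)
  qed
  have h_Psi: "h = ?Psi *\<^sub>v c"
    unfolding c_def by (rule in_range_Psi_mat[OF A P PP hc h_orth])
  have Tc: "T *\<^sub>v c \<in> carrier_vec m" and Pc: "?Psi *\<^sub>v (c - f) \<in> carrier_vec m"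
    and Tcf: "T *\<^sub>v (c - f) \<in> carrier_vec m" and cf: "c - f \<in> carrier_vec N"
    using T Psi(1) cc fc by auto
  \<comment> \<open>The first summand is \<open>- (T - \<Psi>) c\<close>; the second lies in the range of \<open>T\<close>, where the
    product with \<open>w\<close> can be traded for one with \<open>v\<close>, which is orthogonal to \<open>\<Psi>\<close>.\<close>
  have split1: "w = (h - T *\<^sub>v c) + T *\<^sub>v (c - f)"
    using hc Tc qc T cc fc
    by (intro eq_vecI) (auto simp: w_def q_def mult_minus_distrib_mat_vec[of T m N])
  have inner2: "energy_inner A w (T *\<^sub>v (c - f)) = - energy_inner A v (T *\<^sub>v (c - f) - ?Psi *\<^sub>v (c - f))"
  proof -
    have "energy_inner A (T *\<^sub>v (c - f)) x = energy_inner A (T *\<^sub>v (c - f)) q"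
      using gT(2)[OF cf] by (simp add: q_def)
    then have "energy_inner A w (T *\<^sub>v (c - f)) = - energy_inner A v (T *\<^sub>v (c - f))"
      using xc vc qc hc Tcf energy_inner_sym[OF A xc Tcf] energy_inner_sym[OF A qc Tcf]
      by (simp add: w_def h_def energy_inner_diff_left[OF A])
    then show ?thesis
      using Psi(3)[OF vc kerv cf] by (simp add: energy_inner_diff_right[OF A vc Tcf Pc])
  qed
  have Ptw: "P\<^sup>T *\<^sub>v w = c - f"
  proof -
    have "P\<^sup>T *\<^sub>v w = P\<^sup>T *\<^sub>v h - P\<^sup>T *\<^sub>v q"
      using P hc qc by (simp add: w_def mult_minus_distrib_mat_vec[of "P\<^sup>T" N m])
    then show ?thesis
      using left_inverse_mult_vec[OF P T PT fc] by (simp add: c_def q_def)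
  qed
  define E where "E = energy_norm A"
  have Enn: "0 \<le> E y" if "y \<in> carrier_vec m" for y
    using energy_norm_nonneg[OF A that] by (simp add: E_def)
  have coef: "norm2 (P\<^sup>T *\<^sub>v y) \<le> s * E y" if y: "y \<in> carrier_vec m" for y
    using norm2_transpose_orthonormal_le[OF P PP y] s(2)[OF y] by (simp add: E_def)
  have defect: "E (T *\<^sub>v (P\<^sup>T *\<^sub>v y) - ?Psi *\<^sub>v (P\<^sup>T *\<^sub>v y)) \<le> e / 2 * E y"
    if y: "y \<in> carrier_vec m" for y
  proof -
    have "E (T *\<^sub>v (P\<^sup>T *\<^sub>v y) - ?Psi *\<^sub>v (P\<^sup>T *\<^sub>v y)) \<le> \<delta> * norm2 (P\<^sup>T *\<^sub>v y)"
      using d(2)[of "P\<^sup>T *\<^sub>v y"] P y by (simp add: E_def)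
    also have "\<dots> \<le> \<delta> * (s * E y)"
      using coef[OF y] d(1) by (rule mult_left_mono)
    also have "\<dots> \<le> e / 2 * E y"
      using mult_right_mono[OF sd Enn[OF y]] by (simp add: algebra_simps)
    finally show ?thesis .
  qed
  have first: "energy_inner A w (h - T *\<^sub>v c) \<le> E w * (e / 2 * E h)"
  proof -
    have D: "T *\<^sub>v c - h \<in> carrier_vec m"
      using Tc hc by simp
    have "energy_inner A w (h - T *\<^sub>v c) = - energy_inner A w (T *\<^sub>v c - h)"
      using Tc hc wc by (simp add: energy_inner_diff_right[OF A])
    also have "\<dots> \<le> E w * E (T *\<^sub>v c - h)"
      using energy_inner_Cauchy_Schwarz[OF A wc D] by (simp add: E_def)
    also have "\<dots> \<le> E w * (e / 2 * E h)"
      using defect[OF hc, folded c_def, folded h_Psi] Enn[OF wc] by (rule mult_left_mono)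
    finally show ?thesis .
  qed
  have second: "energy_inner A w (T *\<^sub>v (c - f)) \<le> E v * (e / 2 * E w)"
  proof -
    have D: "T *\<^sub>v (c - f) - ?Psi *\<^sub>v (c - f) \<in> carrier_vec m"
      using Tcf Pc by simp
    have "energy_inner A w (T *\<^sub>v (c - f)) \<le> E v * E (T *\<^sub>v (c - f) - ?Psi *\<^sub>v (c - f))"
      using energy_inner_Cauchy_Schwarz[OF A vc D] inner2 by (simp add: E_def)
    also have "\<dots> \<le> E v * (e / 2 * E w)"
      using defect[OF wc, unfolded Ptw] Enn[OF vc] by (rule mult_left_mono)
    finally show ?thesis .
  qed
  have E_v: "E v \<le> E x"
    using gU(4) by (simp add: E_def v_def)
  have E_h: "E h \<le> E x"
  proof -
    have "energy_inner A v h = 0"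
      by (rule h_orth[OF vc kerv])
    then have "energy_inner A h h = energy_inner A x h"
      using energy_inner_diff_left[OF A xc vc hc] by (simp add: h_def)
    then have "(E h)\<^sup>2 \<le> E x * E h"
      using energy_inner_Cauchy_Schwarz[OF A xc hc] energy_norm_square[OF A hc] by (simp add: E_def)
    then show ?thesis
      using Enn[OF hc] Enn[OF xc] by (cases "E h = 0") (auto simp: power2_eq_square)
  qed
  have e: "0 \<le> e"
    using sd mult_nonneg_nonneg[OF s(1) d(1)] by simp
  have "E w * E w = energy_inner A w (h - T *\<^sub>v c) + energy_inner A w (T *\<^sub>v (c - f))"
  proof -
    have "energy_inner A w w = energy_inner A w ((h - T *\<^sub>v c) + T *\<^sub>v (c - f))"
      using split1 by simp
    also have "\<dots> = energy_inner A w (h - T *\<^sub>v c) + energy_inner A w (T *\<^sub>v (c - f))"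
      using hc Tc Tcf wc by (intro energy_inner_add_right[OF A]) auto
    finally show ?thesis
      using energy_norm_square[OF A wc] by (simp add: E_def power2_eq_square)
  qed
  also have "\<dots> \<le> e / 2 * (E h + E v) * E w"
    using first second by (simp add: algebra_simps)
  also have "\<dots> \<le> e * E x * E w"
  proof (rule mult_right_mono[OF _ Enn[OF wc]])
    have "e / 2 * (E h + E v) \<le> e / 2 * (E x + E x)"
      using e E_h E_v by (intro mult_left_mono add_mono) auto
    then show "e / 2 * (E h + E v) \<le> e * E x"
      by simp
  qed
  finally have "E w \<le> e * E x"
    using Enn[OF wc] Enn[OF xc] e by (cases "E w = 0") auto
  moreover have "w = x - (v + q)"
    using xc vc qc by (intro eq_vecI) (auto simp: w_def h_def)
  ultimately show ?thesis
    using energy_norm_minv[OF A b] by (simp add: E_def x_def v_def q_def u_def f_def)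
qed

text \<open>
  Congruence turns the energy norm of \<open>V\<^sup>T A V\<close> into that of \<open>A\<close>, and the right-hand side becomes the
  energy of a projection of \<open>A\<^sup>-\<^sup>1 b\<close>.
\<close>

lemma inexact_galerkin_error:
  assumes A: "spd m A" and V: "full_col_rank m p V" and b: "b \<in> carrier_vec m"
    and fc: "f \<in> carrier_vec p" and e: "0 \<le> e"
    and le: "energy_norm (V\<^sup>T * A * V) (minv (V\<^sup>T * A * V) *\<^sub>v (V\<^sup>T *\<^sub>v b) - f)
        \<le> e * energy_norm (minv (V\<^sup>T * A * V)) (V\<^sup>T *\<^sub>v b)"
  shows "energy_norm A (V *\<^sub>v (minv (V\<^sup>T * A * V) *\<^sub>v (V\<^sup>T *\<^sub>v b)) - V *\<^sub>v f)
        \<le> e * energy_norm (minv A) b"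
proof -
  note g = galerkin_coefficients[OF A V b]
  have Ac: "A \<in> carrier_mat m m" and Vc: "V \<in> carrier_mat m p"
    using A V by auto
  let ?g = "minv (V\<^sup>T * A * V) *\<^sub>v (V\<^sup>T *\<^sub>v b)"
  have "energy_norm A (V *\<^sub>v ?g - V *\<^sub>v f) = energy_norm A (V *\<^sub>v (?g - f))"
    using mult_minus_distrib_mat_vec[OF Vc g(1) fc] by simp
  also have "\<dots> = energy_norm (V\<^sup>T * A * V) (?g - f)"
    using g(1) fc by (intro energy_norm_congruence[OF Ac Vc, symmetric]) auto
  also have "\<dots> \<le> e * energy_norm (minv (V\<^sup>T * A * V)) (V\<^sup>T *\<^sub>v b)"
    by (rule le)
  also have "\<dots> \<le> e * energy_norm (minv A) b"
    using g(3,4) energy_norm_minv[OF A b] e by (intro mult_left_mono) auto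
  finally show ?thesis .
qed

lemma one_level_error:
  assumes A: "spd m A" and U: "full_col_rank m p U" and T: "full_col_rank m N T"
    and b: "b \<in> carrier_vec m" and g: "g \<in> carrier_vec p" and f: "f \<in> carrier_vec N"
    and nonneg: "0 \<le> eB" "0 \<le> eA"
    and split: "energy_norm A (minv A *\<^sub>v b -
      (U *\<^sub>v (minv (U\<^sup>T * A * U) *\<^sub>v (U\<^sup>T *\<^sub>v b)) + T *\<^sub>v (minv (T\<^sup>T * A * T) *\<^sub>v (T\<^sup>T *\<^sub>v b))))
      \<le> e * energy_norm (minv A) b"
    and errB: "energy_norm (U\<^sup>T * A * U) (minv (U\<^sup>T * A * U) *\<^sub>v (U\<^sup>T *\<^sub>v b) - g)
        \<le> eB * energy_norm (minv (U\<^sup>T * A * U)) (U\<^sup>T *\<^sub>v b)"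
    and errA: "energy_norm (T\<^sup>T * A * T) (minv (T\<^sup>T * A * T) *\<^sub>v (T\<^sup>T *\<^sub>v b) - f)
        \<le> eA * energy_norm (minv (T\<^sup>T * A * T)) (T\<^sup>T *\<^sub>v b)"
  shows "energy_norm A (minv A *\<^sub>v b - (U *\<^sub>v g + T *\<^sub>v f)) \<le> (eB + e + eA) * energy_norm (minv A) b"
proof -
  let ?x = "minv A *\<^sub>v b" and ?u = "U *\<^sub>v (minv (U\<^sup>T * A * U) *\<^sub>v (U\<^sup>T *\<^sub>v b))"
    and ?t = "T *\<^sub>v (minv (T\<^sup>T * A * T) *\<^sub>v (T\<^sup>T *\<^sub>v b))"
  have carriers: "?x \<in> carrier_vec m" "?u \<in> carrier_vec m" "?t \<in> carrier_vec m"
    "U *\<^sub>v g \<in> carrier_vec m" "T *\<^sub>v f \<in> carrier_vec m"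
    using spd_mult_minv(1)[OF A b] galerkin_coefficients(1)[OF A U b] galerkin_coefficients(1)[OF A T b]
      full_col_rank_carrier[OF U] full_col_rank_carrier[OF T] g f by auto
  have "x - (v + w) = (x - (u + t)) + ((u - v) + (t - w))"
    if "{x, u, t, v, w} \<subseteq> carrier_vec m" for x u t v w :: "real vec"
    using that by (intro eq_vecI) auto
  then have "?x - (U *\<^sub>v g + T *\<^sub>v f) = (?x - (?u + ?t)) + ((?u - U *\<^sub>v g) + (?t - T *\<^sub>v f))"
    using carriers by blast
  then have "energy_norm A (?x - (U *\<^sub>v g + T *\<^sub>v f)) \<le>
      energy_norm A (?x - (?u + ?t)) + energy_norm A ((?u - U *\<^sub>v g) + (?t - T *\<^sub>v f))"
    using carriers energy_norm_triangle[OF A, of "?x - (?u + ?t)" "(?u - U *\<^sub>v g) + (?t - T *\<^sub>v f)"]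
    by auto
  also have "\<dots> \<le> energy_norm A (?x - (?u + ?t)) + (energy_norm A (?u - U *\<^sub>v g) + energy_norm A (?t - T *\<^sub>v f))"
    using carriers energy_norm_triangle[OF A, of "?u - U *\<^sub>v g" "?t - T *\<^sub>v f"] by auto
  also have "\<dots> \<le> e * energy_norm (minv A) b +
      (eB * energy_norm (minv A) b + eA * energy_norm (minv A) b)"
    using split inexact_galerkin_error[OF A U b g nonneg(1) errB]
      inexact_galerkin_error[OF A T b f nonneg(2) errA] by linarith
  finally show ?thesis
    by (simp add: algebra_simps)
qed


section \<open>Block structure of a level\<close>

lemma vspan_cols:
  assumes X: "X \<in> carrier_mat m k"
  shows "vspan m (set (cols X)) = {X *\<^sub>v c | c. c \<in> carrier_vec k}"
proof -
  interpret vec_space "TYPE(real)" m .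
  show ?thesis
    using col_space_eq[OF X] X unfolding col_space_def by auto
qed

lemma vspan_mat_of_cols:
  assumes "set cs \<subseteq> carrier_vec m"
  shows "vspan m (set cs) = {mat_of_cols m cs *\<^sub>v c | c. c \<in> carrier_vec (length cs)}"
  using vspan_cols[of "mat_of_cols m cs" m "length cs"] assms by simp

lemma vspan_closed:
  assumes S: "S \<subseteq> carrier_vec m"
  shows "S \<subseteq> vspan m S" and "vspan m S \<subseteq> carrier_vec m"
    and "x \<in> vspan m S \<Longrightarrow> y \<in> vspan m S \<Longrightarrow> x + y \<in> vspan m S"
    and "x \<in> vspan m S \<Longrightarrow> y \<in> vspan m S \<Longrightarrow> x - y \<in> vspan m S"
    and "T \<subseteq> vspan m S \<Longrightarrow> vspan m T \<subseteq> vspan m S"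
proof -
  interpret vec_space "TYPE(real)" m .
  show own: "S \<subseteq> vspan m S"
    using in_own_span[OF S] .
  show car: "vspan m S \<subseteq> carrier_vec m"
    using span_closed[OF S] by blast
  show add: "x + y \<in> vspan m S" if "x \<in> vspan m S" "y \<in> vspan m S" for x y
    using span_add1[OF S that] .
  show "x - y \<in> vspan m S" if x: "x \<in> vspan m S" and y: "y \<in> vspan m S"
  proof -
    have "x - y = x + (-1) \<cdot>\<^sub>v y"
      using x y car by (intro eq_vecI) auto
    then show ?thesis
      using add[OF x smult_in_span[OF S y]] by simp
  qed
  show "vspan m T \<subseteq> vspan m S" if "T \<subseteq> vspan m S"
    using span_subsetI[OF S that] .
qed

lemma vspan_orthogonal:
  assumes S: "S \<subseteq> carrier_vec m" and T: "T \<subseteq> carrier_vec m"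
    and orth: "\<And>s t. s \<in> S \<Longrightarrow> t \<in> T \<Longrightarrow> s \<bullet> t = 0"
    and x: "x \<in> vspan m S" and y: "y \<in> vspan m T"
  shows "x \<bullet> y = 0"
proof -
  interpret vec_space "TYPE(real)" m .
  have ortho: "z \<bullet> w = 0" if "R \<subseteq> carrier_vec m" "z \<in> carrier_vec m" "\<And>r. r \<in> R \<Longrightarrow> z \<bullet> r = 0"
    "w \<in> vspan m R" for R z w
    using in_orthogonal_complement_span[OF that(1)] that(2-) unfolding orthogonal_complement_def by blast
  have yc: "y \<in> carrier_vec m" and xc: "x \<in> carrier_vec m"
    using vspan_closed(2)[OF S] vspan_closed(2)[OF T] x y by auto
  have "y \<bullet> s = 0" if s: "s \<in> S" for s
  proof -
    have sc: "s \<in> carrier_vec m"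
      using S s by auto
    then have "s \<bullet> y = 0"
      using ortho[OF T sc] orth[OF s] y by blast
    then show ?thesis
      using comm_scalar_prod[OF sc yc] by simp
  qed
  then have "y \<bullet> x = 0"
    using ortho[OF S yc] x by blast
  then show ?thesis
    using comm_scalar_prod[OF xc yc] by simp
qed

lemma mat_of_cols_append_mult:
  assumes c: "c \<in> carrier_vec (length xs)" and d: "d \<in> carrier_vec (length ys)"
  shows "mat_of_cols m (xs @ ys) *\<^sub>v (c @\<^sub>v d) = mat_of_cols m xs *\<^sub>v c + mat_of_cols m ys *\<^sub>v (d :: real vec)"
proof (rule eq_vecI)
  fix i assume "i < dim_vec (mat_of_cols m xs *\<^sub>v c + mat_of_cols m ys *\<^sub>v d)"
  then have i: "i < m" by simp
  have "row (mat_of_cols m (xs @ ys)) i = row (mat_of_cols m xs) i @\<^sub>v row (mat_of_cols m ys) i"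
    using i by (intro eq_vecI) (auto simp: mat_of_cols_index nth_append)
  then show "(mat_of_cols m (xs @ ys) *\<^sub>v (c @\<^sub>v d)) $ i = (mat_of_cols m xs *\<^sub>v c + mat_of_cols m ys *\<^sub>v d) $ i"
    using i c d scalar_prod_append[of "row (mat_of_cols m xs) i" "length xs" "row (mat_of_cols m ys) i" "length ys" c d]
    by (auto simp: row_def)
qed simp

text \<open>
  If \<open>x + y = 0\<close> with \<open>x\<close> orthogonal to \<open>y\<close>, both vanish.
\<close>

lemma full_col_rank_append:
  assumes xs: "set xs \<subseteq> carrier_vec m" and ys: "set ys \<subseteq> carrier_vec m"
    and X: "full_col_rank m (length xs) (mat_of_cols m xs)"
    and Y: "full_col_rank m (length ys) (mat_of_cols m ys)"
    and orth: "\<And>x y. x \<in> set xs \<Longrightarrow> y \<in> set ys \<Longrightarrow> x \<bullet> y = 0"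
  shows "full_col_rank m (length (xs @ ys)) (mat_of_cols m (xs @ ys))"
  unfolding full_col_rank_def
proof (intro conjI ballI impI)
  fix v assume v: "v \<in> carrier_vec (length (xs @ ys))"
    and 0: "mat_of_cols m (xs @ ys) *\<^sub>v v = 0\<^sub>v m"
  define c d where "c = vec_first v (length xs)" and "d = vec_last v (length ys)"
  have c: "c \<in> carrier_vec (length xs)" and d: "d \<in> carrier_vec (length ys)" and vcd: "v = c @\<^sub>v d"
    using v by (auto simp: c_def d_def)
  let ?x = "mat_of_cols m xs *\<^sub>v c" and ?y = "mat_of_cols m ys *\<^sub>v d"
  have xc: "?x \<in> carrier_vec m" and yc: "?y \<in> carrier_vec m"
    using mult_mat_vec_carrier[OF mat_of_cols_carrier(1) c] mult_mat_vec_carrier[OF mat_of_cols_carrier(1) d]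
    by blast+
  have sum: "?x + ?y = 0\<^sub>v m"
    using 0 mat_of_cols_append_mult[OF c d, of m] vcd by simp
  have "?x \<bullet> ?y = 0"
    using vspan_orthogonal[OF xs ys orth, of ?x ?y] c d
    unfolding vspan_mat_of_cols[OF xs] vspan_mat_of_cols[OF ys] by blast
  then have "?x \<bullet> ?x = ?x \<bullet> (?x + ?y)"
    using xc yc by (simp add: scalar_prod_add_distrib[of _ m])
  then have x0: "?x = 0\<^sub>v m"
    using xc sum by (intro scalar_prod_self_eq_0) auto
  then have "?y = 0\<^sub>v m"
    using sum yc by simp
  with x0 have "c = 0\<^sub>v (length xs)" "d = 0\<^sub>v (length ys)"
    using full_col_rankD[OF X c] full_col_rankD[OF Y d] by auto
  then show "v = 0\<^sub>v (length (xs @ ys))"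
    using vcd by (intro eq_vecI) auto
qed (use mat_of_cols_carrier(1)[of m "xs @ ys"] in simp)

lemma full_col_rank_hcat:
  assumes "\<And>X. X \<in> set Xs \<Longrightarrow> full_col_rank m (dim_col X) X"
    and "sorted_wrt (\<lambda>X Y. \<forall>x\<in>set (cols X). \<forall>y\<in>set (cols Y). x \<bullet> y = 0) Xs"
  shows "full_col_rank m (dim_col (hcat m Xs)) (hcat m Xs)"
  using assms
proof (induction Xs)
  case Nil
  then show ?case
    by (auto simp: hcat_def full_col_rank_def)
next
  case (Cons X Xs)
  have Y: "Y \<in> carrier_mat m (dim_col Y)" if "Y \<in> set (X # Xs)" for Y
    using full_col_rank_carrier[OF Cons.prems(1)[OF that]] .
  have cols_in: "set (cols Y) \<subseteq> carrier_vec m" if "Y \<in> set (X # Xs)" for Y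
    using cols_dim[of Y] Y[OF that] by auto
  let ?ys = "concat (map cols Xs)"
  have rest: "full_col_rank m (length ?ys) (mat_of_cols m ?ys)"
    using Cons.IH Cons.prems by (simp add: hcat_def)
  have X: "full_col_rank m (length (cols X)) (mat_of_cols m (cols X))"
    using Cons.prems(1)[of X] mat_of_cols_cols[of X] carrier_matD(1)[OF Y[of X]] by simp
  have "full_col_rank m (length (cols X @ ?ys)) (mat_of_cols m (cols X @ ?ys))"
    using Cons.prems(2) cols_in by (intro full_col_rank_append[OF _ _ X rest]) auto
  then show ?case
    by (simp add: hcat_def)
qed

lemma full_col_rank_if_basis:
  assumes X: "X \<in> carrier_mat m k" and dist: "distinct (cols X)"
    and B: "basis_of m W (set (cols X))"
  shows "full_col_rank m k X"
proof -
  interpret vec_space "TYPE(real)" m .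
  show ?thesis
    using lin_depI[OF X _ _ _ dist] B X unfolding full_col_rank_def basis_of_def by blast
qed

text \<open>
  The dimension count that identifies the number of columns of \<open>U\<close>.
\<close>

lemma full_col_rank_spanning_square:
  assumes X: "full_col_rank m k X" and span: "vspan m (set (cols X)) = carrier_vec m"
  shows "k = m"
proof -
  interpret vec_space "TYPE(real)" m .
  have Xc: "X \<in> carrier_mat m k"
    using X by simp
  have dist: "distinct (cols X)"
  proof (rule ccontr)
    assume "\<not> distinct (cols X)"
    then obtain i j where ij: "i < k" "j < k" "i \<noteq> j" "col X i = col X j"
      using Xc by (auto simp: distinct_conv_nth)
    let ?c = "unit_vec k i - unit_vec k j :: real vec"
    have unit: "X *\<^sub>v unit_vec k a = col X a" if "a < k" for a
      using Xc that by (intro eq_vecI) auto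
    have "X *\<^sub>v ?c = col X i - col X j"
      using Xc ij by (simp add: mult_minus_distrib_mat_vec[of X m k] unit)
    then have "?c = 0\<^sub>v k"
      using full_col_rankD[OF X, of ?c] ij Xc by simp
    then have "?c $ i = 0"
      using ij by simp
    then show False
      using ij by simp
  qed
  have "lin_indpt (set (cols X))"
    using lin_depE[OF Xc _ dist] full_col_rankD[OF X] by metis
  then have "basis (set (cols X))"
    using span cols_dim[of X] Xc unfolding basis_def by auto
  then have "dim = card (set (cols X))"
    by (intro dim_basis) auto
  then show ?thesis
    using dim_is_n dist Xc by (simp add: distinct_card)
qed

text \<open>
  Pairwise orthogonality is stated by position in the list, which for unit vectors also excludes
  repeated columns, and it reduces to conditions within the blocks and between them.
\<close>

lemma sorted_wrt_concat:
  assumes "\<And>xs. xs \<in> set xss \<Longrightarrow> sorted_wrt R xs"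
    and "sorted_wrt (\<lambda>xs ys. \<forall>x\<in>set xs. \<forall>y\<in>set ys. R x y) xss"
  shows "sorted_wrt R (concat xss)"
  using assms by (induction xss) (auto simp: sorted_wrt_append)

lemma sorted_wrt_upt_if_distinct:
  assumes "\<And>i j. i < M \<Longrightarrow> j < M \<Longrightarrow> i \<noteq> j \<Longrightarrow> R (f i) (f j)"
  shows "sorted_wrt R (map f [0..<M])"
  using assms by (auto simp: sorted_wrt_map sorted_wrt_iff_nth_less)

lemma orthonormal_cols:
  fixes X :: "real mat"
  assumes X: "X \<in> carrier_mat m k"
    and one: "\<And>x. x \<in> set (cols X) \<Longrightarrow> x \<bullet> x = 1"
    and orth: "sorted_wrt (\<lambda>x y. x \<bullet> y = 0) (cols X)"
  shows "X\<^sup>T * X = 1\<^sub>m k"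
proof (rule eq_matI)
  fix i j assume "i < dim_row (1\<^sub>m k :: real mat)" "j < dim_col (1\<^sub>m k :: real mat)"
  then have i: "i < k" and j: "j < k" by auto
  have lt: "col X i \<bullet> col X j = 0" if "i < j" "j < k" for i j
    using sorted_wrt_nth_less[OF orth that(1)] X that by simp
  have "col X i \<bullet> col X j = (if i = j then 1 else 0)"
  proof (cases i j rule: linorder_cases)
    case less
    then show ?thesis using lt j by simp
  next
    case equal
    then show ?thesis
      using one[of "col X i"] X i cols_nth[of i X] nth_mem[of i "cols X"] by simp
  next
    case greater
    then have "col X j \<bullet> col X i = 0" using lt i by simp
    then show ?thesis
      using greater X i j comm_scalar_prod[of "col X j" m "col X i"] by simp
  qed
  then show "(X\<^sup>T * X) $$ (i, j) = 1\<^sub>m k $$ (i, j)"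
    using X i j by simp
qed (use X in auto)

lemma cols_hcat:
  assumes "\<And>X. X \<in> set Xs \<Longrightarrow> dim_row X = m"
  shows "cols (hcat m Xs) = concat (map cols Xs)"
proof -
  have "set (cols X) \<subseteq> carrier_vec m" if "X \<in> set Xs" for X
    using cols_dim[of X] assms[OF that] by simp
  then show ?thesis
    unfolding hcat_def by (intro cols_mat_of_cols) auto
qed

context
  fixes A :: "real mat" and m :: nat and l :: level
  assumes ok: "level_ok A m l"
begin

lemma patch_subset: "j < npatch l \<Longrightarrow> patch l j \<subseteq> basisV l"
  using ok by (auto simp: level_ok_def)

lemma basisV_carrier: "basisV l \<subseteq> carrier_vec m"
  and vspan_basisV: "vspan m (basisV l) = carrier_vec m"
  using ok by (auto simp: level_ok_def orthonormal_basis_of_def basis_of_def)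

lemma patch_carrier: "j < npatch l \<Longrightarrow> patch l j \<subseteq> carrier_vec m"
  using patch_subset basisV_carrier by blast

text \<open>
  Disjoint patches consist of different vectors of one orthonormal basis.  All orthogonality between
  different blocks of \<open>\<Phi>\<close> and \<open>U\<close> comes from here.
\<close>

lemma vspan_patches_orthogonal:
  assumes ij: "i < npatch l" "j < npatch l" "i \<noteq> j"
    and x: "x \<in> vspan m (patch l i)" and y: "y \<in> vspan m (patch l j)"
  shows "x \<bullet> y = 0"
proof (rule vspan_orthogonal[OF patch_carrier[OF ij(1)] patch_carrier[OF ij(2)] _ x y])
  fix s t assume st: "s \<in> patch l i" "t \<in> patch l j"
  have "patch l i \<inter> patch l j = {}"
    using ok ij by (auto simp: level_ok_def disjoint_family_on_def)
  then have "s \<noteq> t"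
    using st by auto
  moreover have "s \<in> basisV l" "t \<in> basisV l"
    using st patch_subset ij by auto
  ultimately show "s \<bullet> t = 0"
    using ok by (simp add: level_ok_def orthonormal_basis_of_def)
qed

lemma phi_block:
  assumes j: "j < npatch l"
  shows "phi_block l j \<in> carrier_mat m (dim_col (phi_block l j))"
    and "set (cols (phi_block l j)) \<subseteq> vspan m (patch l j)"
    and "x \<in> set (cols (phi_block l j)) \<Longrightarrow> x \<bullet> x = 1"
    and "sorted_wrt (\<lambda>x y. x \<bullet> y = 0) (cols (phi_block l j))"
proof -
  let ?X = "phi_block l j"
  obtain W where W: "W \<subseteq> vspan m (patch l j)" "orthonormal_basis_of m W (set (cols ?X))"
    and dist: "distinct (cols ?X)" and dim: "dim_row ?X = m"
    using ok j unfolding level_ok_def by blast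
  show "?X \<in> carrier_mat m (dim_col ?X)"
    using dim by auto
  have "set (cols ?X) \<subseteq> vspan m (set (cols ?X))"
    using cols_dim[of ?X] dim by (intro vspan_closed(1)) simp
  then show "set (cols ?X) \<subseteq> vspan m (patch l j)"
    using W by (auto simp: orthonormal_basis_of_def basis_of_def)
  have on: "x \<bullet> y = (if x = y then 1 else 0)" if "x \<in> set (cols ?X)" "y \<in> set (cols ?X)" for x y
    using W that by (simp add: orthonormal_basis_of_def)
  show "x \<bullet> x = 1" if "x \<in> set (cols ?X)"
    using on[OF that that] by simp
  show "sorted_wrt (\<lambda>x y. x \<bullet> y = 0) (cols ?X)"
    unfolding sorted_wrt_iff_nth_less using dist on by (auto simp del: cols_nth simp: nth_eq_iff_index_eq)
qed

lemma u_block: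
  assumes j: "j < npatch l"
  shows "full_col_rank m (dim_col (u_block l j)) (u_block l j)"
    and "vspan m (set (cols (u_block l j))) =
      orth_complement_in (vspan m (patch l j)) (vspan m (set (cols (phi_block l j))))"
    and "set (cols (u_block l j)) \<subseteq> orth_complement_in (vspan m (patch l j)) (vspan m (set (cols (phi_block l j))))"
proof -
  let ?X = "u_block l j" and ?W = "orth_complement_in (vspan m (patch l j)) (vspan m (set (cols (phi_block l j))))"
  have dim: "dim_row ?X = m" and dist: "distinct (cols ?X)"
    and B: "basis_of m ?W (set (cols ?X))"
    using ok j unfolding level_ok_def by auto
  have X: "?X \<in> carrier_mat m (dim_col ?X)"
    using dim by auto
  show "full_col_rank m (dim_col ?X) ?X"
    by (rule full_col_rank_if_basis[OF X dist B])
  show span: "vspan m (set (cols ?X)) = ?W"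
    using B by (simp add: basis_of_def)
  show "set (cols ?X) \<subseteq> ?W"
    using vspan_closed(1)[of "set (cols ?X)" m] cols_dim[of ?X] dim span by simp
qed

lemma cols_Phi_mat: "cols (Phi_mat m l) = concat (map (\<lambda>j. cols (phi_block l j)) [0..<npatch l])"
  unfolding Phi_mat_def using carrier_matD(1)[OF phi_block(1)] by (subst cols_hcat) (auto simp: comp_def)

lemma cols_U_mat: "cols (U_mat m l) = concat (map (\<lambda>j. cols (u_block l j)) [0..<npatch l])"
  unfolding U_mat_def using carrier_matD(1)[OF full_col_rank_carrier[OF u_block(1)]]
  by (subst cols_hcat) (auto simp: comp_def)

lemma Phi_mat_carrier: "Phi_mat m l \<in> carrier_mat m (dim_col (Phi_mat m l))"
  by (simp add: Phi_mat_def hcat_def)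

lemma U_mat_carrier: "U_mat m l \<in> carrier_mat m (dim_col (U_mat m l))"
  by (simp add: U_mat_def hcat_def)

lemma cols_carrier:
  "set (cols (Phi_mat m l)) \<subseteq> carrier_vec m" "set (cols (U_mat m l)) \<subseteq> carrier_vec m"
  using cols_dim[of "Phi_mat m l"] cols_dim[of "U_mat m l"] by (simp_all add: Phi_mat_def U_mat_def hcat_def)

lemma mat_of_cols_Phi_U:
  "mat_of_cols m (cols (Phi_mat m l)) = Phi_mat m l" "mat_of_cols m (cols (U_mat m l)) = U_mat m l"
  using mat_of_cols_cols[of "Phi_mat m l"] mat_of_cols_cols[of "U_mat m l"]
    carrier_matD(1)[OF Phi_mat_carrier] carrier_matD(1)[OF U_mat_carrier] by metis+

lemma Phi_mat_orthonormal: "(Phi_mat m l)\<^sup>T * Phi_mat m l = 1\<^sub>m (dim_col (Phi_mat m l))"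
proof (rule orthonormal_cols[OF Phi_mat_carrier])
  show "x \<bullet> x = 1" if "x \<in> set (cols (Phi_mat m l))" for x
    using that phi_block(3) by (auto simp: cols_Phi_mat)
  show "sorted_wrt (\<lambda>x y. x \<bullet> y = 0) (cols (Phi_mat m l))"
    unfolding cols_Phi_mat
  proof (rule sorted_wrt_concat)
    show "sorted_wrt (\<lambda>x y. x \<bullet> y = 0) xs"
      if "xs \<in> set (map (\<lambda>j. cols (phi_block l j)) [0..<npatch l])" for xs
      using that phi_block(4) by auto
    show "sorted_wrt (\<lambda>xs ys. \<forall>x\<in>set xs. \<forall>y\<in>set ys. x \<bullet> y = 0)
        (map (\<lambda>j. cols (phi_block l j)) [0..<npatch l])"
      using vspan_patches_orthogonal phi_block(2) by (intro sorted_wrt_upt_if_distinct) blast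
  qed
qed

lemma U_mat_full_col_rank: "full_col_rank m (dim_col (U_mat m l)) (U_mat m l)"
  unfolding U_mat_def
proof (rule full_col_rank_hcat)
  show "full_col_rank m (dim_col X) X" if "X \<in> set (map (u_block l) [0..<npatch l])" for X
    using that u_block(1) by auto
  show "sorted_wrt (\<lambda>X Y. \<forall>x\<in>set (cols X). \<forall>y\<in>set (cols Y). x \<bullet> y = 0) (map (u_block l) [0..<npatch l])"
  proof (rule sorted_wrt_upt_if_distinct, intro ballI)
    fix i j x y assume ij: "i < npatch l" "j < npatch l" "i \<noteq> j"
      and "x \<in> set (cols (u_block l i))" "y \<in> set (cols (u_block l j))"
    then have "x \<in> vspan m (patch l i)" "y \<in> vspan m (patch l j)"
      using u_block(3) by (auto simp: orth_complement_in_def)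
    then show "x \<bullet> y = 0"
      by (rule vspan_patches_orthogonal[OF ij])
  qed
qed

lemma Phi_cols_orthogonal_U_cols:
  assumes x: "x \<in> set (cols (Phi_mat m l))" and y: "y \<in> set (cols (U_mat m l))"
  shows "x \<bullet> y = 0"
proof -
  obtain i j where i: "i < npatch l" "x \<in> set (cols (phi_block l i))"
    and j: "j < npatch l" "y \<in> set (cols (u_block l j))"
    using x y by (auto simp: cols_Phi_mat cols_U_mat)
  have xP: "x \<in> vspan m (patch l i)"
    using phi_block(2)[OF i(1)] i(2) by blast
  have yP: "y \<in> vspan m (patch l j)" and y_orth: "\<And>z. z \<in> vspan m (set (cols (phi_block l j))) \<Longrightarrow> y \<bullet> z = 0"
    using u_block(3)[OF j(1)] j(2) by (auto simp: orth_complement_in_def)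
  show ?thesis
  proof (cases "i = j")
    case True
    have "set (cols (phi_block l i)) \<subseteq> carrier_vec m"
      using cols_dim[of "phi_block l i"] phi_block(1)[OF i(1)] by auto
    then have "x \<in> vspan m (set (cols (phi_block l j)))"
      using subsetD[OF vspan_closed(1)] i(2) True by simp
    then have "y \<bullet> x = 0"
      by (rule y_orth)
    then show ?thesis
      using comm_scalar_prod[OF subsetD[OF vspan_closed(2)[OF patch_carrier[OF i(1)]] xP]
          subsetD[OF vspan_closed(2)[OF patch_carrier[OF j(1)]] yP]] by simp
  next
    case False
    then show ?thesis
      using vspan_patches_orthogonal[OF i(1) j(1) False xP yP] by simp
  qed
qed

text \<open>
  Each basis vector lies in some patch, and is the sum of its orthogonal projection onto the span of
  the \<open>\<Phi>\<close>-block of that patch and a remainder in the span of the \<open>U\<close>-block.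
\<close>

lemma vspan_Phi_U:
  "vspan m (set (cols (Phi_mat m l) @ cols (U_mat m l))) = carrier_vec m"
proof -
  let ?C = "set (cols (Phi_mat m l) @ cols (U_mat m l))"
  have C: "?C \<subseteq> carrier_vec m"
    using cols_carrier by simp
  have bases: "(\<Union>j<npatch l. patch l j) = basisV l"
    using ok by (simp add: level_ok_def)
  have "v \<in> vspan m ?C" if v: "v \<in> basisV l" for v
  proof -
    obtain j where j: "j < npatch l" "v \<in> patch l j"
      using v unfolding bases[symmetric] by auto
    let ?X = "phi_block l j"
    define k where "k = dim_col ?X"
    have X: "?X \<in> carrier_mat m k"
      unfolding k_def by (rule phi_block(1)[OF j(1)])
    have vc: "v \<in> carrier_vec m"
      using basisV_carrier v by blast
    have P: "patch l j \<subseteq> carrier_vec m"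
      using patch_carrier[OF j(1)] .
    have Xc: "set (cols ?X) \<subseteq> carrier_vec m"
      using cols_dim[of ?X] X by auto
    have XX: "?X\<^sup>T * ?X = 1\<^sub>m k"
      by (rule orthonormal_cols[OF X phi_block(3)[OF j(1)] phi_block(4)[OF j(1)]])
    let ?c = "?X\<^sup>T *\<^sub>v v"
    let ?t = "?X *\<^sub>v ?c"
    have c: "?c \<in> carrier_vec k" and tc: "?t \<in> carrier_vec m"
      using X vc by (simp_all add: mult_mat_vec_carrier[of _ m k] mult_mat_vec_carrier[of _ k m])
    have t: "?t \<in> vspan m (set (cols ?X))"
      unfolding vspan_cols[OF X] using c by blast
    have "?t \<in> vspan m (patch l j)"
      using subsetD[OF vspan_closed(5)[OF P phi_block(2)[OF j(1)]] t] .
    then have "v - ?t \<in> vspan m (patch l j)"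
      using vspan_closed(4)[OF P subsetD[OF vspan_closed(1)[OF P] j(2)]] by simp
    moreover have "(v - ?t) \<bullet> y = 0" if y: "y \<in> vspan m (set (cols ?X))" for y
    proof -
      obtain d where d: "d \<in> carrier_vec k" "y = ?X *\<^sub>v d"
        using y unfolding vspan_cols[OF X] by blast
      have "?X\<^sup>T *\<^sub>v (v - ?t) = ?c - ?X\<^sup>T *\<^sub>v ?t"
        using X vc tc by (intro mult_minus_distrib_mat_vec[of _ k m]) auto
      also have "\<dots> = 0\<^sub>v k"
        using left_inverse_mult_vec[OF X X XX c] c by simp
      finally show ?thesis
        using transpose_vec_mult_scalar[OF X d(1), of "v - ?t"] d vc tc by simp
    qed
    ultimately have "v - ?t \<in> vspan m (set (cols (u_block l j)))"
      using u_block(2)[OF j(1)] by (simp add: orth_complement_in_def)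
    moreover have "set (cols (u_block l j)) \<subseteq> ?C" "set (cols ?X) \<subseteq> ?C"
      using j(1) by (auto simp: cols_Phi_mat cols_U_mat)
    then have "vspan m (set (cols (u_block l j))) \<subseteq> vspan m ?C" "vspan m (set (cols ?X)) \<subseteq> vspan m ?C"
      using vspan_closed(5)[OF C subset_trans[OF _ vspan_closed(1)[OF C]]] by metis+
    ultimately have "v - ?t \<in> vspan m ?C" "?t \<in> vspan m ?C"
      using t by (meson subsetD)+
    then have "v - ?t + ?t \<in> vspan m ?C"
      by (rule vspan_closed(3)[OF C])
    moreover have "v - ?t + ?t = v"
      using vec_minus_add[OF vc tc] .
    ultimately show ?thesis
      by simp
  qed
  then have "carrier_vec m \<subseteq> vspan m ?C"
    using vspan_closed(5)[OF C, of "basisV l"] vspan_basisV by blast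
  then show ?thesis
    using vspan_closed(2)[OF C] by blast
qed

lemma Phi_U_full_col_rank:
  defines "cs \<equiv> cols (Phi_mat m l) @ cols (U_mat m l)"
  shows "full_col_rank m (length cs) (mat_of_cols m cs)"
proof -
  have P: "full_col_rank m (dim_col (Phi_mat m l)) (Phi_mat m l)"
    by (rule full_col_rank_if_left_inverse[OF Phi_mat_carrier _ Phi_mat_orthonormal])
      (rule transpose_carrier_mat[THEN iffD2, OF Phi_mat_carrier])
  show ?thesis
    unfolding cs_def using P U_mat_full_col_rank Phi_cols_orthogonal_U_cols
    by (intro full_col_rank_append[OF cols_carrier]) (simp_all add: mat_of_cols_Phi_U)
qed

lemma dim_col_U_mat: "dim_col (U_mat m l) = m - dim_col (Phi_mat m l)"
proof -
  let ?cs = "cols (Phi_mat m l) @ cols (U_mat m l)"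
  have "set ?cs \<subseteq> carrier_vec m"
    using cols_carrier by simp
  then have "length ?cs = m"
    using vspan_Phi_U by (intro full_col_rank_spanning_square[OF Phi_U_full_col_rank]) simp
  then show ?thesis
    by simp
qed

text \<open>
  Since \<open>[\<Phi>, U]\<close> spans everything, \<open>y = \<Phi> c + U d\<close>, and \<open>\<Phi>\<^sup>T y = c\<close> by orthonormality.
\<close>

lemma Phi_mat_kernel:
  assumes y: "y \<in> carrier_vec m"
  shows "(Phi_mat m l)\<^sup>T *\<^sub>v y = 0\<^sub>v (dim_col (Phi_mat m l)) \<longleftrightarrow>
    (\<exists>c\<in>carrier_vec (m - dim_col (Phi_mat m l)). y = U_mat m l *\<^sub>v c)"
proof -
  let ?P = "Phi_mat m l" and ?U = "U_mat m l"
  define N p where "N = dim_col ?P" and "p = dim_col ?U"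
  have P: "?P \<in> carrier_mat m N" and U: "?U \<in> carrier_mat m p"
    unfolding N_def p_def by (rule Phi_mat_carrier U_mat_carrier)+
  have PP: "?P\<^sup>T * ?P = 1\<^sub>m N"
    unfolding N_def by (rule Phi_mat_orthonormal)
  have lengths: "length (cols ?P) = N" "length (cols ?U) = p"
    by (simp_all add: N_def p_def)
  have PU: "?P\<^sup>T *\<^sub>v (?U *\<^sub>v c) = 0\<^sub>v N" if c: "c \<in> carrier_vec p" for c
  proof (rule eq_vecI)
    fix i assume "i < dim_vec (0\<^sub>v N :: real vec)"
    then have i: "i < N" by simp
    have "col ?P i \<bullet> (?U *\<^sub>v c) = 0"
    proof (rule vspan_orthogonal[of "set (cols ?P)" m "set (cols ?U)"])
      have "col ?P i \<in> set (cols ?P)"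
        using i nth_mem[of i "cols ?P"] lengths(1) P by simp
      then show "col ?P i \<in> vspan m (set (cols ?P))"
        using vspan_closed(1)[OF cols_carrier(1)] by blast
      show "?U *\<^sub>v c \<in> vspan m (set (cols ?U))"
        unfolding vspan_cols[OF U] using c by blast
    qed (use cols_carrier Phi_cols_orthogonal_U_cols in auto)
    then show "(?P\<^sup>T *\<^sub>v (?U *\<^sub>v c)) $ i = 0\<^sub>v N $ i"
      using i P by simp
  qed (simp add: N_def)
  have "\<exists>c\<in>carrier_vec p. y = ?U *\<^sub>v c" if 0: "?P\<^sup>T *\<^sub>v y = 0\<^sub>v N"
  proof -
    let ?cs = "cols ?P @ cols ?U"
    have cs: "set ?cs \<subseteq> carrier_vec m"
      using cols_carrier by simp
    have "y \<in> vspan m (set ?cs)"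
      unfolding vspan_Phi_U by (rule y)
    then obtain v where v: "v \<in> carrier_vec (N + p)" "y = mat_of_cols m ?cs *\<^sub>v v"
      unfolding vspan_mat_of_cols[OF cs] using lengths by auto
    define c d where "c = vec_first v N" and "d = vec_last v p"
    have c: "c \<in> carrier_vec N" and d: "d \<in> carrier_vec p" and vcd: "v = c @\<^sub>v d"
      using v by (auto simp: c_def d_def)
    have y_eq: "y = ?P *\<^sub>v c + ?U *\<^sub>v d"
      using v(2) vcd mat_of_cols_append_mult[of c "cols ?P" d "cols ?U" m] c d lengths
      by (simp add: mat_of_cols_Phi_U)
    have Pc: "?P *\<^sub>v c \<in> carrier_vec m" and Ud: "?U *\<^sub>v d \<in> carrier_vec m"
      using P U c d by (simp_all add: mult_mat_vec_carrier[of _ m N] mult_mat_vec_carrier[of _ m p])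
    have "?P\<^sup>T *\<^sub>v y = ?P\<^sup>T *\<^sub>v (?P *\<^sub>v c) + ?P\<^sup>T *\<^sub>v (?U *\<^sub>v d)"
      unfolding y_eq using P by (intro mult_add_distrib_mat_vec[OF _ Pc Ud]) simp
    then have "c = 0\<^sub>v N"
      using 0 PU[OF d] left_inverse_mult_vec[OF P P PP c] c by simp
    then show ?thesis
      using y_eq P Ud d by auto
  qed
  then show ?thesis
    using PU unfolding N_def p_def dim_col_U_mat by blast
qed

lemma psi_loc_carrier: "psi_loc l \<in> carrier_mat m (dim_col (Phi_mat m l))"
  using ok by (simp add: level_ok_def local_approximator_def)

lemma Phi_psi_loc: "(Phi_mat m l)\<^sup>T * psi_loc l = 1\<^sub>m (dim_col (Phi_mat m l))"
proof -
  let ?P = "Phi_mat m l"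
  define N where "N = dim_col ?P"
  have P: "?P \<in> carrier_mat m N" and T: "psi_loc l \<in> carrier_mat m N"
    unfolding N_def by (rule Phi_mat_carrier psi_loc_carrier)+
  have "?P\<^sup>T * psi_loc l = 1\<^sub>m N"
  proof (rule eq_matI)
    fix i' i assume "i' < dim_row (1\<^sub>m N :: real mat)" "i < dim_col (1\<^sub>m N :: real mat)"
    then have i': "i' < N" and i: "i < N" by auto
    have "col ?P i \<in> set (cols ?P)"
      using i nth_mem[of i "cols ?P"] P by simp
    then obtain j where j: "j < npatch l" "col ?P i \<in> set (cols (phi_block l j))"
      by (auto simp: cols_Phi_mat)
    have "local_approximator A m l"
      using ok by (simp add: level_ok_def)
    then obtain r where "is_local_psi A m l j i r (col (psi_loc l) i)"
      using j i unfolding N_def local_approximator_def by blast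
    then have "col ?P i' \<bullet> col (psi_loc l) i = (if i' = i then 1 else 0)"
      using i' unfolding N_def is_local_psi_def is_arg_min_def by blast
    then show "((Phi_mat m l)\<^sup>T * psi_loc l) $$ (i', i) = 1\<^sub>m N $$ (i', i)"
      using i i' P T by simp
  qed (use P T in auto)
  then show ?thesis
    by (simp add: N_def)
qed

lemma psi_loc_full_col_rank: "full_col_rank m (dim_col (Phi_mat m l)) (psi_loc l)"
  by (rule full_col_rank_if_left_inverse[OF psi_loc_carrier _ Phi_psi_loc])
    (rule transpose_carrier_mat[THEN iffD2, OF Phi_mat_carrier])

end


section \<open>The multilevel solver\<close>

lemma linear_map_closed:
  assumes "linear_map class_ring (Rvec p) (Rvec q) F" and "b \<in> carrier_vec p"
  shows "F b \<in> carrier_vec q"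
proof -
  have "F \<in> LinearCombinations.module_hom class_ring (Rvec p) (Rvec q)"
    using assms(1) unfolding linear_map_def mod_hom_def mod_hom_axioms_def by blast
  then have "F \<in> carrier (Rvec p) \<rightarrow> carrier (Rvec q)"
    by (rule LinearCombinations.module_hom_closed)
  then show ?thesis
    using assms(2) by (auto simp: module_vec_simps)
qed

lemma localized_basis_error:
  assumes A: "spd m A" and T: "T \<in> carrier_mat m N" and P: "P \<in> carrier_mat m N"
    and d: "0 \<le> \<delta>" "\<And>i. i < N \<Longrightarrow> energy_norm A (col T i - col P i) \<le> \<delta>"
    and c: "c \<in> carrier_vec N"
  shows "energy_norm A (T *\<^sub>v c - P *\<^sub>v c) \<le> sqrt N * \<delta> * norm2 c"
proof -
  have cols: "col (T - P) i = col T i - col P i" if "i < N" for i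
    using T P that by (intro eq_vecI) auto
  have "T *\<^sub>v c - P *\<^sub>v c = (T - P) *\<^sub>v c"
    by (rule minus_mult_distrib_mat_vec[OF T P c, symmetric])
  then show ?thesis
    using energy_norm_mult_le_of_cols[OF A minus_carrier_mat[OF P, of T] d(1) _ c] cols d(2) by simp
qed

context
  fixes A :: "real mat" and n K :: nat and L :: "nat \<Rightarrow> level"
  assumes spdA: "spd n A" and multires: "multires_decomposition n A K L"
begin

lemma level_ok_Suc: "k < K \<Longrightarrow> level_ok (levA A L k) (levN n L k) (L (Suc k))"
  using multires unfolding multires_decomposition_def by (metis Suc_leI atLeastAtMost_iff diff_Suc_1 le_add1 plus_1_eq_Suc)

lemma spd_levA: "k \<le> K \<Longrightarrow> spd (levN n L k) (levA A L k)"
proof (induction k)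
  case 0
  then show ?case using spdA by simp
next
  case (Suc k)
  then show ?case
    using spd_congruence[OF _ psi_loc_full_col_rank[OF level_ok_Suc]] by simp
qed

text \<open>
  One constant serves all levels: a coarse vector is recovered from the fine one it represents by
  \<open>\<Phi>\<^sup>T\<close>, which does not increase Euclidean length, while its energy is by definition that of the fine
  vector.  This is why the localization tolerance
  can be expressed through \<open>\<parallel>A\<^sup>-\<^sup>1\<parallel>\<close> at every level.
\<close>

lemma norm2_le_levA:
  assumes "k \<le> K" "y \<in> carrier_vec (levN n L k)"
  shows "norm2 y \<le> sqrt (spectral_norm (minv A)) * energy_norm (levA A L k) y"
  using assms
proof (induction k arbitrary: y)
  case 0
  then show ?case using norm2_le_energy_norm[OF spdA] by simp
next
  case (Suc k)
  let ?m = "levN n L k" and ?l = "L (Suc k)"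
  let ?T = "psi_loc ?l" and ?P = "Phi_mat ?m ?l" and ?s = "sqrt (spectral_norm (minv A))"
  have ok: "level_ok (levA A L k) ?m ?l"
    using Suc.prems level_ok_Suc by simp
  have P: "?P \<in> carrier_mat ?m (levN n L (Suc k))" and T: "?T \<in> carrier_mat ?m (levN n L (Suc k))"
    and PP: "?P\<^sup>T * ?P = 1\<^sub>m (levN n L (Suc k))" and PT: "?P\<^sup>T * ?T = 1\<^sub>m (levN n L (Suc k))"
    using Phi_mat_carrier[OF ok] psi_loc_carrier[OF ok] Phi_mat_orthonormal[OF ok] Phi_psi_loc[OF ok]
    unfolding levN.simps by blast+
  note y = Suc.prems(2)
  have Ty: "?T *\<^sub>v y \<in> carrier_vec ?m"
    by (rule mult_mat_vec_carrier[OF T y])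
  have "norm2 y = norm2 (?P\<^sup>T *\<^sub>v (?T *\<^sub>v y))"
    using left_inverse_mult_vec[OF P T PT y] by simp
  also have "\<dots> \<le> norm2 (?T *\<^sub>v y)"
    by (rule norm2_transpose_orthonormal_le[OF P PP Ty])
  also have "\<dots> \<le> ?s * energy_norm (levA A L k) (?T *\<^sub>v y)"
    using Suc.IH[OF _ Ty] Suc.prems by simp
  also have "energy_norm (levA A L k) (?T *\<^sub>v y) = energy_norm (levA A L (Suc k)) y"
    using energy_norm_congruence[OF spd_carrier[OF spd_levA] T y] Suc.prems by simp
  finally show ?case .
qed

lemma solver_error_step:
  assumes k: "k < K"
    and b: "b \<in> carrier_vec (levN n L k)"
    and InvB: "\<And>b. b \<in> carrier_vec (levN n L k - levN n L (Suc k)) \<Longrightarrow>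
      InvB (Suc k) b \<in> carrier_vec (levN n L k - levN n L (Suc k))"
    and nonneg: "0 \<le> err_B" "0 \<le> err_loc" "0 \<le> err"
    and errB: "\<And>b. b \<in> carrier_vec (levN n L k - levN n L (Suc k)) \<Longrightarrow>
      energy_norm (levB n A L (Suc k)) (minv (levB n A L (Suc k)) *\<^sub>v b - InvB (Suc k) b)
        \<le> err_B * energy_norm (minv (levB n A L (Suc k))) b"
    and loc: "\<And>i. i < levN n L (Suc k) \<Longrightarrow>
      energy_norm (levA A L k) (col (psi_loc (L (Suc k))) i - col (levPsi n A L (Suc k)) i)
        \<le> err_loc / (2 * sqrt (real (levN n L (Suc k)) * spectral_norm (minv A)))"
    and coarse: "\<And>b. b \<in> carrier_vec (levN n L (Suc k)) \<Longrightarrow>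
      solver n K L InvB InvAK (Suc k) b \<in> carrier_vec (levN n L (Suc k)) \<and>
      energy_norm (levA A L (Suc k)) (minv (levA A L (Suc k)) *\<^sub>v b - solver n K L InvB InvAK (Suc k) b)
        \<le> err * energy_norm (minv (levA A L (Suc k))) b"
  shows "solver n K L InvB InvAK k b \<in> carrier_vec (levN n L k)"
    and "energy_norm (levA A L k) (minv (levA A L k) *\<^sub>v b - solver n K L InvB InvAK k b)
        \<le> (err_B + err_loc + err) * energy_norm (minv (levA A L k)) b"
proof -
  define m N where "m = levN n L k" and "N = levN n L (Suc k)"
  define l where "l = L (Suc k)"
  define D P T U where "D = levA A L k" and "P = Phi_mat m l" and "T = psi_loc l" and "U = U_mat m l"
  define s where "s = sqrt (spectral_norm (minv A))"
  have D: "spd m D"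
    unfolding D_def m_def using k by (intro spd_levA) simp
  have ok: "level_ok D m l"
    unfolding D_def m_def l_def by (rule level_ok_Suc[OF k])
  have N: "dim_col (Phi_mat m l) = N"
    by (simp add: N_def m_def l_def)
  note P = Phi_mat_carrier[OF ok, unfolded N, folded P_def]
  note PP = Phi_mat_orthonormal[OF ok, unfolded N, folded P_def]
  note T = psi_loc_carrier[OF ok, unfolded N, folded T_def]
  note PT = Phi_psi_loc[OF ok, unfolded N, folded P_def T_def]
  note Tr = psi_loc_full_col_rank[OF ok, unfolded N, folded T_def]
  note U = U_mat_full_col_rank[OF ok, unfolded dim_col_U_mat[OF ok] N, folded U_def]
  note kernel = Phi_mat_kernel[OF ok, unfolded N, folded P_def U_def]
  have levA_Suc: "levA A L (Suc k) = T\<^sup>T * D * T"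
    by (simp add: T_def D_def l_def)
  have levB_Suc: "levB n A L (Suc k) = U\<^sup>T * D * U"
    by (simp add: levB_def levU_def U_def D_def l_def m_def)
  have levPsi_Suc: "levPsi n A L (Suc k) = Psi_mat D P"
    by (simp add: levPsi_def P_def D_def l_def m_def)
  have bc: "b \<in> carrier_vec m"
    using b by (simp add: m_def)
  let ?g = "InvB (Suc k) (U\<^sup>T *\<^sub>v b)" and ?f = "solver n K L InvB InvAK (Suc k) (T\<^sup>T *\<^sub>v b)"
  have Uc: "U \<in> carrier_mat m (m - N)"
    using U by simp
  have Ub: "U\<^sup>T *\<^sub>v b \<in> carrier_vec (m - N)" and Tb: "T\<^sup>T *\<^sub>v b \<in> carrier_vec N"
    using Uc T bc by auto
  have g: "?g \<in> carrier_vec (m - N)"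
    using InvB[folded m_def N_def, OF Ub] .
  note f = coarse[folded N_def, unfolded levA_Suc, OF Tb]
  have solver: "solver n K L InvB InvAK k b = U *\<^sub>v ?g + T *\<^sub>v ?f"
    using k by (subst solver.simps) (simp add: levU_def U_def T_def l_def m_def)
  show "solver n K L InvB InvAK k b \<in> carrier_vec (levN n L k)"
    unfolding solver m_def[symmetric] using Uc T g f by auto
  have lam: "0 \<le> spectral_norm (minv A)"
    by (rule spectral_norm_nonneg[OF spd_minv(1)[OF spdA]])
  define \<delta>\<^sub>0 where "\<delta>\<^sub>0 = err_loc / (2 * sqrt (real N * spectral_norm (minv A)))"
  have d0: "0 \<le> \<delta>\<^sub>0"
    using nonneg lam by (simp add: \<delta>\<^sub>0_def)
  have psi: "energy_norm D (T *\<^sub>v c - Psi_mat D P *\<^sub>v c) \<le> sqrt N * \<delta>\<^sub>0 * norm2 c"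
    if "c \<in> carrier_vec N" for c
    using loc[unfolded levPsi_Suc, folded N_def D_def l_def T_def] that
    by (intro localized_basis_error[OF D T Psi_mat_props(1)[OF D P PP] d0]) (simp_all add: \<delta>\<^sub>0_def)
  \<comment> \<open>Equality, unless \<open>N = 0\<close> or \<open>\<parallel>A\<^sup>-\<^sup>1\<parallel> = 0\<close>, when division by zero makes the left side \<open>0\<close>.\<close>
  have sd: "s * (sqrt N * \<delta>\<^sub>0) \<le> err_loc / 2"
    using nonneg lam by (cases "real N * spectral_norm (minv A) = 0") (auto simp: s_def \<delta>\<^sub>0_def real_sqrt_mult)
  have s: "0 \<le> s"
    using lam by (simp add: s_def)
  have norm: "norm2 y \<le> s * energy_norm D y" if "y \<in> carrier_vec m" for y
    using norm2_le_levA[of k y] k that by (simp add: s_def D_def m_def)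
  have "0 \<le> sqrt N * \<delta>\<^sub>0"
    using d0 by simp
  note split = localization_defect[OF D U P PP kernel T PT s norm this psi sd bc]
  show "energy_norm (levA A L k) (minv (levA A L k) *\<^sub>v b - solver n K L InvB InvAK k b)
        \<le> (err_B + err_loc + err) * energy_norm (minv (levA A L k)) b"
    unfolding solver D_def[symmetric]
    by (rule one_level_error[OF D U Tr bc g conjunct1[OF f] nonneg(1,3) split
          errB[folded m_def N_def, unfolded levB_Suc, OF Ub] conjunct2[OF f]])
qed

end

theorem theorem6p8:
  fixes A :: "real mat" and n K :: nat and L :: "nat \<Rightarrow> level"
    and InvB :: "nat \<Rightarrow> real vec \<Rightarrow> real vec" and InvAK :: "real vec \<Rightarrow> real vec"
    and err_B err_A err_loc :: real
  assumes "spd n A" and "1 \<le> K"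
    and "multires_decomposition n A K L"
    and "\<And>k. k \<in> {1..K} \<Longrightarrow>
           linear_map class_ring (Rvec (levN n L (k - 1) - levN n L k))
             (Rvec (levN n L (k - 1) - levN n L k)) (InvB k)"
    and "linear_map class_ring (Rvec (levN n L K)) (Rvec (levN n L K)) InvAK"
    and "0 \<le> err_B" and "0 \<le> err_A" and "0 \<le> err_loc"
    and "\<And>k b. k \<in> {1..K} \<Longrightarrow> b \<in> carrier_vec (levN n L (k - 1) - levN n L k) \<Longrightarrow>
           energy_norm (levB n A L k) (minv (levB n A L k) *\<^sub>v b - InvB k b)
             \<le> err_B * energy_norm (minv (levB n A L k)) b"
    and "\<And>b. b \<in> carrier_vec (levN n L K) \<Longrightarrow>
           energy_norm (levA A L K) (minv (levA A L K) *\<^sub>v b - InvAK b)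
             \<le> err_A * energy_norm (minv (levA A L K)) b"
    and "\<And>k i. k \<in> {1..K} \<Longrightarrow> i < levN n L k \<Longrightarrow>
           energy_norm (levA A L (k - 1)) (col (psi_loc (L k)) i - col (levPsi n A L k) i)
             \<le> err_loc / (2 * sqrt (real (levN n L k) * spectral_norm (minv A)))"
  shows "(\<forall>b\<in>carrier_vec n.
            energy_norm A (minv A *\<^sub>v b - solver n K L InvB InvAK 0 b)
              \<le> (real K * (err_B + err_loc) + err_A) * energy_norm (minv A) b) \<and>
         (\<forall>b\<in>carrier_vec n.
            norm2 (minv A *\<^sub>v b - solver n K L InvB InvAK 0 b)
              \<le> (real K * (err_B + err_loc) + err_A) * spectral_norm (minv A) * norm2 b)"
proof -
  let ?S = "solver n K L InvB InvAK" and ?lam = "spectral_norm (minv A)"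
  have level: "\<forall>b\<in>carrier_vec (levN n L k). ?S k b \<in> carrier_vec (levN n L k) \<and>
      energy_norm (levA A L k) (minv (levA A L k) *\<^sub>v b - ?S k b)
        \<le> (real (K - k) * (err_B + err_loc) + err_A) * energy_norm (minv (levA A L k)) b"
    if "k \<le> K" for k
    using that
  proof (induction k rule: inc_induct)
    case base
    have "?S K = InvAK"
      by (rule ext) (simp add: solver.simps)
    then show ?case
      using assms(10) linear_map_closed[OF assms(5)] by simp
  next
    case (step k)
    have k: "Suc k \<in> {1..K}"
      using step.hyps by simp
    have rate: "err_B + err_loc + (real (K - Suc k) * (err_B + err_loc) + err_A)
        = real (K - k) * (err_B + err_loc) + err_A"
      using step.hyps by (simp add: of_nat_diff algebra_simps)
    have "0 \<le> real (K - Suc k) * (err_B + err_loc) + err_A"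
      using assms(6-8) by simp
    note st = solver_error_step[OF assms(1,3) \<open>k < K\<close> _ _ assms(6,8) this, of _ InvB InvAK, unfolded rate]
    show ?case
      using st linear_map_closed[OF assms(4)[OF k]] assms(9)[OF k] assms(11)[OF k] step.IH by simp
  qed
  define err where "err = real K * (err_B + err_loc) + err_A"
  have "0 \<le> err"
    using assms(6-8) by (simp add: err_def)
  have energy: "energy_norm A (minv A *\<^sub>v b - ?S 0 b) \<le> err * energy_norm (minv A) b"
    and closed: "?S 0 b \<in> carrier_vec n" if "b \<in> carrier_vec n" for b
    using level[of 0] that by (simp_all add: err_def)
  have "norm2 (minv A *\<^sub>v b - ?S 0 b) \<le> err * ?lam * norm2 b" if b: "b \<in> carrier_vec n" for b
  proof -
    have lam: "0 \<le> ?lam"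
      by (rule spectral_norm_nonneg[OF spd_minv(1)[OF assms(1)]])
    have "norm2 (minv A *\<^sub>v b - ?S 0 b) \<le> sqrt ?lam * energy_norm A (minv A *\<^sub>v b - ?S 0 b)"
      using spd_mult_minv(1)[OF assms(1) b] closed[OF b]
      by (intro norm2_le_energy_norm[OF assms(1)]) simp
    also have "\<dots> \<le> sqrt ?lam * (err * (sqrt ?lam * norm2 b))"
      using energy[OF b] mult_left_mono[OF energy_norm_minv_le_norm2[OF assms(1) b] \<open>0 \<le> err\<close>] lam
      by (intro mult_left_mono) auto
    also have "\<dots> = err * (sqrt ?lam * sqrt ?lam) * norm2 b"
      by (simp only: ac_simps)
    also have "\<dots> = err * ?lam * norm2 b"
      using lam by simp
    finally show ?thesis .
  qed
  then show ?thesis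
    using energy unfolding err_def by blast
qed

end
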